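(* Let $n,d$ be integers with $4\leq d\leq n-2$, and let $G\in\mathcal{U}_{n,d}$. Then $SO(G)\leq SO(U_{n}^{d})$, with equality if and only if $G\cong U_{n}^{d}$.
   Context: All graphs are finite, simple and connected. For a graph $G$, $d_u=d_G(u)$ denotes the degree of the vertex $u$, and the Sombor index is $$SO(G)=\sum_{uv\in E(G)}\sqrt{d_{u}^{2}+d_{v}^{2}}.$$ The diameter of $G$ is the maximum distance between two vertices of $G$. A unicyclic graph is a connected graph containing exactly one cycle (equivalently, a connected graph with as many edges as vertices). $\mathcal{U}_{n,d}$ denotes the set of unicyclic graphs with $n$ vertices and diameter $d$. For $4\leq d\leq n-2$, $U_n^d\in\mathcal{U}_{n,d}$ is the following graph: take a path $u_1u_2\cdots u_du_{d+1}$ on $d+1$ vertices, add a new vertex $w$ adjacent to exactly $u_2$ and $u_4$ (so that $u_2u_3u_4w$ is a 4-cycle), and attach $n-d-2$ further pendent vertices (vertices of degree 1) to $u_2$. Its Sombor index is $$SO(U_{n}^{d})=(n-d-1)\sqrt{(n-d+1)^{2}+1}+2\sqrt{(n-d+1)^{2}+4}+F_{1},$$ where $F_{1}=2\sqrt{13}+\sqrt{10}$ if $d=4$ and $F_{1}=2\sqrt{2}(d-5)+3\sqrt{13}+\sqrt{5}$ if $d\geq 5$. *)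

theory Defs
  imports Complex_Main "Graph_Theory.Graph_Theory"
begin

text \<open>
  A finite simple graph is a \<^locale>\<open>pair_graph\<close>: a finite, loop-free digraph whose arcs are a
  symmetric set of ordered pairs. An undirected edge \<open>uv\<close> is thus represented by the two arcs
  \<open>(u, v)\<close> and \<open>(v, u)\<close>; \<open>edge_set\<close> merges them into the single two-element set \<open>{u, v}\<close>.
\<close>

definition edge_set :: "'a pair_pre_digraph \<Rightarrow> 'a set set" where
  "edge_set G = (\<lambda>(u, v). {u, v}) ` parcs G"

text \<open>As the arcs are symmetric, the out-degree is the number of neighbours.\<close>

abbreviation degree :: "'a pair_pre_digraph \<Rightarrow> 'a \<Rightarrow> nat" where
  "degree G v \<equiv> out_degree (with_proj G) v"

text \<open>For an edge \<open>e = {u, v}\<close> of a loop-free graph the inner sum is \<open>d\<^sub>u\<^sup>2 + d\<^sub>v\<^sup>2\<close>.\<close>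

definition sombor_index :: "'a pair_pre_digraph \<Rightarrow> real" where
  "sombor_index G = (\<Sum>e\<in>edge_set G. sqrt (\<Sum>v\<in>e. (real (degree G v))\<^sup>2))"

text \<open>The distance and diameter are only meaningful for connected graphs.\<close>

definition graph_dist :: "'a pair_pre_digraph \<Rightarrow> 'a \<Rightarrow> 'a \<Rightarrow> nat" where
  "graph_dist G u v = (LEAST k. \<exists>p. pre_digraph.awalk (with_proj G) u p v \<and> length p = k)"

definition diameter :: "'a pair_pre_digraph \<Rightarrow> nat" where
  "diameter G = Max {graph_dist G u v | u v. u \<in> pverts G \<and> v \<in> pverts G}"

text \<open>
  A directed cycle of a symmetric digraph is a cycle of the undirected graph unless it is of the
  form \<open>u, v, u\<close>, so cycles of length at least 3 are required. Directed cycles differing only in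
  their starting point or direction give the same undirected cycle; the latter is identified
  with its set of edges.
\<close>

definition is_cycle :: "'a pair_pre_digraph \<Rightarrow> 'a set set \<Rightarrow> bool" where
  "is_cycle G C \<longleftrightarrow>
     (\<exists>p. pre_digraph.cycle (with_proj G) p \<and> 3 \<le> length p \<and> C = (\<lambda>(u, v). {u, v}) ` set p)"

definition unicyclic :: "'a pair_pre_digraph \<Rightarrow> bool" where
  "unicyclic G \<longleftrightarrow>
     pair_graph G \<and> Digraph_Component.connected (with_proj G) \<and> (\<exists>!C. is_cycle G C)"

definition unicyclic_graphs :: "nat \<Rightarrow> nat \<Rightarrow> 'a pair_pre_digraph set" where
  "unicyclic_graphs n d = {G. unicyclic G \<and> card (pverts G) = n \<and> diameter G = d}"

text \<open>
  The graph \<open>U\<^sub>n\<^sup>d\<close>, for \<open>4 \<le> d \<le> n - 2\<close>, on the vertices \<open>1, \<dots>, n\<close>: the path vertex \<open>u\<^sub>i\<close> is \<open>i\<close> for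
  \<open>i \<le> d + 1\<close>, the vertex \<open>w\<close> is \<open>d + 2\<close>, and the further pendent vertices at \<open>u\<^sub>2\<close> are
  \<open>d + 3, \<dots>, n\<close>. The function \<open>symcl\<close> is the symmetric closure.
\<close>

definition extremal_graph :: "nat \<Rightarrow> nat \<Rightarrow> nat pair_pre_digraph" where
  "extremal_graph n d =
     \<lparr>pverts = {1..n},
      parcs = symcl ({(i, i + 1) | i. 1 \<le> i \<and> i \<le> d}
                   \<union> {(2, d + 2), (4, d + 2)}
                   \<union> {(2, j) | j. d + 3 \<le> j \<and> j \<le> n})\<rparr>"

definition isomorphic :: "'a pair_pre_digraph \<Rightarrow> 'b pair_pre_digraph \<Rightarrow> bool" where
  "isomorphic G H \<longleftrightarrow> digraph_iso (with_proj G) (with_proj H)"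

end

theory Submission
  imports Defs
begin

text \<open>
  Let \<open>p\<close> be a diametral path of a unicyclic graph and \<open>m = n - d - 1\<close> the number of outer vertices,
  those not on \<open>p\<close>. The graph has as many edges as vertices, so \<open>m + 1\<close> of its edges are not on \<open>p\<close>.
  The bound is proved by induction on \<open>m\<close>.

  If all outer vertices are adjacent to one inner vertex \<open>p i\<close>, only one further edge is left; as
  \<open>p\<close> is a geodesic it joins two outer vertices or leads from an outer vertex to \<open>p j\<close> with
  \<open>\<bar>i - j\<bar> \<le> 2\<close>, and the index can be computed. Otherwise every degree is at most \<open>m + 1\<close>, and
  removing an outer leaf lowers the index by strictly less than the difference of the extremal values
  for \<open>m\<close> and \<open>m - 1\<close>, because \<open>sqrt (x\<^sup>2 + y\<^sup>2)\<close> is convex in \<open>x\<close> and its increments in \<open>x\<close> decrease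
  with \<open>y\<close>. If there is no outer leaf, the degrees exceed those of a cycle by 2 in total (up to the
  ends of \<open>p\<close>), so the index is close to \<open>n * sqrt 8\<close>, which is too small.
\<close>

section \<open>Edge weights\<close>

text \<open>Why a common neighbour of all outer vertices is treated apart: the removal of a leaf at
  a vertex of degree \<open>s + 1\<close> is estimated as if its other \<open>s\<close> neighbours
  were leaves too. From \<open>m - 1\<close> to \<open>m\<close> the extremal value grows by
  \<open>hyp (m + 1) 1 + m * D1 + 2 * D2\<close>, where \<open>D1\<close> and \<open>D2\<close> are
  the increments of \<open>hyp x 1\<close> and \<open>hyp x 2\<close> from \<open>x = m + 1\<close>
  to \<open>x = m + 2\<close>; the term with \<open>D2\<close> comes from the two cycle neighbours
  of the centre. For \<open>s = m\<close> the estimate stays below this by convexity, but for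
  \<open>s = m + 1\<close> it is \<open>hyp (m + 1) 1 + (m + 2) * D1\<close>, which is too large
  because \<open>D2 < D1\<close>. Degree \<open>m + 2\<close> requires an inner path vertex adjacent
  to all outer vertices, and then the graph is simple enough for an exact computation.

  That computation also settles equality, as all other branches are strict. For \<open>m = 1\<close>
  the cycle of the extremal graph may lie at either end of \<open>p\<close>, so equality leads to
  two positions that are mirror images.\<close>

definition hyp :: "real \<Rightarrow> real \<Rightarrow> real" where
  "hyp x y = sqrt (x\<^sup>2 + y\<^sup>2)"

lemma hyp_commute: "hyp x y = hyp y x"
  by (simp add: hyp_def add.commute)

lemma hyp_mono: "\<lbrakk>0 \<le> x; x \<le> x'; 0 \<le> y; y \<le> y'\<rbrakk> \<Longrightarrow> hyp x y \<le> hyp x' y'"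
  unfolding hyp_def by (intro real_sqrt_le_mono add_mono power_mono) auto

lemma hyp_pos: "0 < x \<Longrightarrow> 0 < hyp x y"
  by (simp add: hyp_def add_pos_nonneg)

text \<open>Rationalising makes the numerator independent of \<open>x\<close>; the increments then
  shrink as \<open>x\<close> grows because the denominator grows.\<close>

lemma hyp_diff_eq:
  assumes "0 < x"
  shows "hyp x b - hyp x a = (b\<^sup>2 - a\<^sup>2) / (hyp x b + hyp x a)"
proof -
  have "(hyp x b - hyp x a) * (hyp x b + hyp x a) = (hyp x b)\<^sup>2 - (hyp x a)\<^sup>2"
    by (simp add: algebra_simps power2_eq_square)
  also have "\<dots> = b\<^sup>2 - a\<^sup>2"
    by (simp add: hyp_def)
  finally show ?thesis
    using hyp_pos[OF assms, of b] hyp_pos[OF assms, of a] by (simp add: eq_divide_eq)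
qed

lemma hyp_diff_antimono:
  assumes "0 < x" "x \<le> x'" "0 \<le> a" "a \<le> b"
  shows "hyp x' b - hyp x' a \<le> hyp x b - hyp x a"
proof -
  have "hyp x b + hyp x a \<le> hyp x' b + hyp x' a"
    using assms by (intro add_mono hyp_mono) auto
  moreover have "a\<^sup>2 \<le> b\<^sup>2"
    using assms by (intro power_mono)
  moreover have "0 < hyp x b + hyp x a" 
    using assms by (intro add_pos_pos hyp_pos)
  ultimately have "(b\<^sup>2 - a\<^sup>2) / (hyp x' b + hyp x' a) \<le> (b\<^sup>2 - a\<^sup>2) / (hyp x b + hyp x a)"
    by (intro divide_left_mono mult_pos_pos) auto
  then show ?thesis
    using assms by (simp add: hyp_diff_eq)
qed

lemma hyp_diff_strict_antimono:
  assumes "0 < x" "x < x'" "0 \<le> a" "a < b"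
  shows "hyp x' b - hyp x' a < hyp x b - hyp x a"
proof -
  have "hyp x b < hyp x' b" "hyp x a < hyp x' a"
    using assms by (auto simp: hyp_def intro!: power_strict_mono)
  moreover have "a\<^sup>2 < b\<^sup>2"
    using assms by (intro power_strict_mono) auto
  moreover have "0 < hyp x b + hyp x a" 
    using assms by (intro add_pos_pos hyp_pos)
  ultimately have "(b\<^sup>2 - a\<^sup>2) / (hyp x' b + hyp x' a) < (b\<^sup>2 - a\<^sup>2) / (hyp x b + hyp x a)"
    by (intro divide_strict_left_mono mult_pos_pos) auto
  then show ?thesis
    using assms by (simp add: hyp_diff_eq)
qed

text \<open>Midpoint convexity is the triangle inequality in the complex plane: the two outer points
  sum to twice the middle one.\<close>

lemma hyp_convex: "hyp (x + 1) y - hyp x y \<le> hyp (x + 2) y - hyp (x + 1) y"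
proof -
  have "cmod (Complex x y + Complex (x + 2) y) \<le> cmod (Complex x y) + cmod (Complex (x + 2) y)"
    by (rule norm_triangle_ineq)
  moreover have "Complex x y + Complex (x + 2) y = 2 * Complex (x + 1) y"
    by (simp add: complex_eq_iff)
  ultimately have "2 * cmod (Complex (x + 1) y) \<le> cmod (Complex x y) + cmod (Complex (x + 2) y)"
    by (simp add: norm_mult)
  then show ?thesis
    by (simp add: hyp_def complex_norm)
qed

section \<open>Numerical bounds and comparisons with the extremal value\<close>

lemma sqrt_bounds:
  "2.236 < sqrt (5::real)" "sqrt (5::real) < 2.2361"
  "2.8284 < sqrt (8::real)" "sqrt (8::real) < 2.8285"
  "3.1622 < sqrt (10::real)" "sqrt (10::real) < 3.1623"
  "3.6055 < sqrt (13::real)" "sqrt (13::real) < 3.6056"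
  "4.1231 < sqrt (17::real)"
  "sqrt (18::real) < 4.2427" 
  "4.4721 < sqrt (20::real)" "sqrt (20::real) < 4.4722"
  "sqrt (32::real) < 5.6569"
  by (((rule real_less_rsqrt | rule real_less_lsqrt); simp add: power2_eq_square)+)

lemma hyp_numerals:
  "hyp 2 1 = sqrt 5" "hyp 1 2 = sqrt 5" "hyp 2 2 = sqrt 8" "hyp 3 1 = sqrt 10" "hyp 1 3 = sqrt 10"
  "hyp 3 2 = sqrt 13" "hyp 2 3 = sqrt 13" "hyp 3 3 = sqrt 18" "hyp 4 1 = sqrt 17" "hyp 4 2 = sqrt 20"
  by (simp_all add: hyp_def)

lemma hyp_2_1_diff: "3 \<le> x \<Longrightarrow> hyp x 2 - hyp x 1 \<le> sqrt 13 - sqrt 10"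
  using hyp_diff_antimono[of 3 x 1 2] by (simp add: hyp_numerals)

text \<open>The total weight of a path of \<open>l\<close> edges, its inner vertices having degree 2, that leads
  from a vertex of degree \<open>x\<close> to a leaf. At \<open>l = 0\<close> the value is junk.\<close>

definition tail_weight :: "real \<Rightarrow> nat \<Rightarrow> real" where
  "tail_weight x l =
     (if l = 1 then hyp x 1 else hyp x 2 + (real l - 2) * sqrt 8 + sqrt 5)"

lemma tail_weight_1 [simp]: "tail_weight x (Suc 0) = hyp x 1"
  by (simp add: tail_weight_def)

lemma tail_weight_ge_2: "2 \<le> l \<Longrightarrow> tail_weight x l = hyp x 2 + (real l - 2) * sqrt 8 + sqrt 5"
  by (simp add: tail_weight_def)

text \<open>This is the index of \<open>extremal_graph n d\<close> for \<open>m = n - d - 1\<close>: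
  the centre of degree \<open>m + 2\<close> has \<open>m\<close> leaves and two cycle neighbours of
  degree 2, \<open>2 * sqrt 13\<close> is the far half of the 4-cycle, and a tail of
  \<open>d - 3\<close> edges starts at its vertex of degree 3. The case split in \<open>F_1\<close>
  is the one in \<open>tail_weight\<close>.\<close>

definition extremal_value :: "nat \<Rightarrow> nat \<Rightarrow> real" where
  "extremal_value m d =
     m * hyp (m + 2) 1 + 2 * hyp (m + 2) 2 + 2 * sqrt 13 + tail_weight 3 (d - 3)"

text \<open>All but one edge of the tail at \<open>x\<close> are moved to the tail at the vertex of
  degree 3. This costs \<open>hyp x 2 - hyp x 1\<close>, at most \<open>sqrt 13 - sqrt 10\<close>;
  if \<open>i\<close> is at least 2, it gains \<open>sqrt 8 - sqrt 5\<close>, which is larger, when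
  \<open>2 \<le> l\<close>, and exactly \<open>sqrt 13 - sqrt 10\<close> when \<open>l = 1\<close>.
  Hence balance is possible only if the tails merely swap places.\<close>

lemma tail_weight_merge:
  assumes "3 \<le> x" "1 \<le> i" "1 \<le> l"
  shows "tail_weight x i + tail_weight 3 l \<le> hyp x 1 + tail_weight 3 (i + l - 1)"
    and "tail_weight x i + tail_weight 3 l = hyp x 1 + tail_weight 3 (i + l - 1) \<Longrightarrow>
      i = 1 \<or> x = 3 \<and> l = 1"
proof -
  consider "i = 1" | "2 \<le> i" "2 \<le> l" | "2 \<le> i" "l = 1"
    using assms by linarith
  then have "tail_weight x i + tail_weight 3 l \<le> hyp x 1 + tail_weight 3 (i + l - 1) \<and>
    (tail_weight x i + tail_weight 3 l = hyp x 1 + tail_weight 3 (i + l - 1) \<longrightarrow>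
      i = 1 \<or> x = 3 \<and> l = 1)"
  proof cases
    case 2
    then have "hyp x 1 + tail_weight 3 (i + l - 1) - (tail_weight x i + tail_weight 3 l)
        = sqrt 8 - sqrt 5 - (hyp x 2 - hyp x 1)"
      by (simp add: tail_weight_ge_2 of_nat_diff algebra_simps)
    moreover have "\<dots> > 0"
      using hyp_2_1_diff[OF assms(1)] sqrt_bounds by linarith
    ultimately show ?thesis
      by linarith
  next
    case 3
    then have *: "hyp x 1 + tail_weight 3 (i + l - 1) - (tail_weight x i + tail_weight 3 l)
        = sqrt 13 - sqrt 10 - (hyp x 2 - hyp x 1)"
      by (simp add: tail_weight_ge_2 of_nat_diff algebra_simps hyp_numerals)
    show ?thesis
    proof (cases "x = 3")
      case True
      with * 3 show ?thesis
        by (simp add: hyp_numerals)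
    next
      case False
      then have "hyp x 2 - hyp x 1 < sqrt 13 - sqrt 10"
        using hyp_diff_strict_antimono[of 3 x 1 2] assms by (simp add: hyp_numerals)
      with * show ?thesis
        by linarith
    qed
  qed auto
  then show "tail_weight x i + tail_weight 3 l \<le> hyp x 1 + tail_weight 3 (i + l - 1)"
    and "tail_weight x i + tail_weight 3 l = hyp x 1 + tail_weight 3 (i + l - 1) \<Longrightarrow>
      i = 1 \<or> x = 3 \<and> l = 1"
    by auto
qed

lemma tail_weight_merge_same:
  assumes "3 \<le> x" "1 \<le> i" "1 \<le> l" "4 \<le> i + l"
  shows "tail_weight x i + tail_weight x l
    \<le> hyp x 1 + hyp x 2 + (real (i + l) - 3) * sqrt 8 + sqrt 5"
proof -
  have "hyp x 2 - hyp x 1 < sqrt 8 - sqrt 5"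
    using hyp_2_1_diff[OF assms(1)] sqrt_bounds by linarith
  moreover consider "i = 1" "2 \<le> l" | "2 \<le> i" "2 \<le> l" | "2 \<le> i" "l = 1"
    using assms by linarith
  \<comment> \<open>The \<open>max\<close> unites the three cases: its second argument is the exact
    excess when both tails are long. By the first fact it is negative, so the term vanishes.\<close>
  then have "tail_weight x i + tail_weight x l \<le> hyp x 1 + hyp x 2 + (real (i + l) - 3) * sqrt 8
      + sqrt 5 + max 0 (hyp x 2 - hyp x 1 - (sqrt 8 - sqrt 5))"
    by cases (simp_all add: tail_weight_ge_2 of_nat_diff algebra_simps)
  ultimately show ?thesis
    by simp
qed

text \<open>Meant for the graphs in which the centre is the only vertex of degree above 2: the
  further edge joins two outer vertices or ends at an end of the path.\<close>

lemma extremal_value_gt_no_branch: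
  assumes "1 \<le> m" "4 \<le> d"
  shows "(real m - 1) * hyp (m + 2) 1 + 3 * hyp (m + 2) 2 + (real d - 2) * sqrt 8 + sqrt 5
    < extremal_value m d"
proof -
  have "hyp (m + 2) 2 - hyp (m + 2) 1 \<le> sqrt 13 - sqrt 10"
    using assms by (intro hyp_2_1_diff) simp
  moreover have "(real d - 2) * sqrt 8 + sqrt 5 + (sqrt 13 - sqrt 10) <
    2 * sqrt 13 + tail_weight 3 (d - 3)"
  proof (cases "d = 4")
    case True
    then show ?thesis
      using sqrt_bounds by (simp add: hyp_numerals)
  next
    case False
    with assms have "2 \<le> d - 3"
      by simp
    then show ?thesis
      using sqrt_bounds by (simp add: tail_weight_ge_2 of_nat_diff hyp_numerals algebra_simps)
  qed
  ultimately show ?thesis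
    unfolding extremal_value_def by (simp add: algebra_simps)
qed

text \<open>The competitor has a triangle through the centre in place of the 4-cycle, with the tail
  at the centre already shortened to one edge by \<open>tail_weight_merge\<close>.\<close>

lemma extremal_value_gt_triangle:
  assumes "1 \<le> m" "4 \<le> d"
  shows "m * hyp (m + 2) 1 + hyp (m + 2) 2 + hyp (m + 2) 3 + sqrt 13 + tail_weight 3 (d - 2)
    < extremal_value m d"
proof -
  have "hyp (m + 2) 3 - hyp (m + 2) 2 \<le> sqrt 18 - sqrt 13"
    using hyp_diff_antimono[of 3 "m + 2" 2 3] assms by (simp add: hyp_numerals)
  moreover have "sqrt 18 - sqrt 13 + tail_weight 3 (d - 2) < sqrt 13 + tail_weight 3 (d - 3)"
  proof (cases "d = 4")
    case True
    then show ?thesis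
      using sqrt_bounds by (simp add: hyp_numerals tail_weight_def)
  next
    case False
    with assms have "2 \<le> d - 3" "2 \<le> d - 2"
      by simp_all
    then show ?thesis
      using sqrt_bounds by (simp add: tail_weight_ge_2 of_nat_diff hyp_numerals algebra_simps)
  qed
  ultimately show ?thesis
    unfolding extremal_value_def by (simp add: algebra_simps)
qed

lemma hyp_step_mono:
  assumes "s \<le> t"
  shows "hyp (real s + 1) 1 - hyp (real s) 1 \<le> hyp (real t + 1) 1 - hyp (real t) 1"
  using assms
proof (induction rule: dec_induct)
  case (step k)
  then show ?case
    using hyp_convex[of "real k" 1] by (simp add: add.commute)
qed simp

text \<open>With \<open>s \<le> m\<close>, convexity bounds the terms in \<open>s\<close> by the
  growth of the leaf edges at the centre; the growth of the two cycle edges at the centre remains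
  and makes the inequality strict.\<close>

lemma extremal_value_step:
  assumes "2 \<le> m" "s \<le> m"
  shows "extremal_value (m - 1) d + hyp (real s + 1) 1
      + real s * (hyp (real s + 1) 1 - hyp (real s) 1) < extremal_value m d"
proof -
  have "hyp (real s + 1) 1 \<le> hyp (real m + 1) 1"
    using assms by (intro hyp_mono) auto
  moreover have "real s * (hyp (real s + 1) 1 - hyp (real s) 1)
      \<le> real m * (hyp (real m + 2) 1 - hyp (real m + 1) 1)"
    using hyp_step_mono[of s "m + 1"] assms hyp_mono[of "real s" "real s + 1" 1 1]
    by (intro mult_mono) (auto simp: add.commute)
  moreover have "hyp (real m + 1) 2 < hyp (real m + 2) 2"
    using assms by (auto simp: hyp_def intro!: power_strict_mono)
  moreover define e where "e = extremal_value (m - 1) d"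
  moreover have "extremal_value m d - e
    = hyp (real m + 1) 1 + real m * (hyp (real m + 2) 1 - hyp (real m + 1) 1)
      + 2 * (hyp (real m + 2) 2 - hyp (real m + 1) 2)"
    using assms unfolding e_def extremal_value_def by (simp add: of_nat_diff algebra_simps)
  ultimately show ?thesis
    unfolding e_def[symmetric] by argo
qed

lemma extremal_value_gt_flat:
  assumes "2 \<le> m" "4 \<le> d"
  shows "(real m + real d + 1) * sqrt 8 + 4 * (sqrt 20 - sqrt 8) < extremal_value m d"
proof -
  have "sqrt 17 \<le> hyp (m + 2) 1" "sqrt 20 \<le> hyp (m + 2) 2"
    using hyp_mono[of 4 "m + 2" 1 1] hyp_mono[of 4 "m + 2" 2 2] assms by (simp_all add: hyp_numerals)
  \<comment> \<open>Each leaf edge at the centre outweighs \<open>sqrt 8\<close>, so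
    \<open>m = 2\<close> is the critical case and only a numerical check is left.\<close>
  moreover have "2 * (sqrt 17 - sqrt 8) \<le> real m * (hyp (m + 2) 1 - sqrt 8)"
    using assms \<open>sqrt 17 \<le> _\<close> sqrt_bounds by (intro mult_mono) auto
  moreover have "(real d + 1) * sqrt 8 + 4 * (sqrt 20 - sqrt 8) <
      2 * (sqrt 17 - sqrt 8) + 2 * sqrt 20 + 2 * sqrt 13 + tail_weight 3 (d - 3)"
  proof (cases "d = 4")
    case True
    then show ?thesis
      using sqrt_bounds by (simp add: hyp_numerals)
  next
    case False
    with assms have "2 \<le> d - 3"
      by simp
    then show ?thesis
      using sqrt_bounds by (simp add: tail_weight_ge_2 of_nat_diff hyp_numerals algebra_simps)
  qed
  ultimately show ?thesis
    unfolding extremal_value_def by (simp add: algebra_simps)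
qed

text \<open>With base value \<open>sqrt 8\<close> for an edge between vertices of degree 2, the excess of an edge
  is split between its two ends.\<close>

definition degree_excess :: "nat \<Rightarrow> real" where
  "degree_excess k = (if k \<le> 2 then 0 else if k = 3 then sqrt 13 - sqrt 8 else sqrt 20 - sqrt 8)"

lemma hyp_le_degree_excess:
  assumes "a \<le> 4" "b \<le> 4"
  shows "hyp (real a) (real b) \<le> sqrt 8 + degree_excess a + degree_excess b"
proof -
  \<comment> \<open>Degrees below 2 may be raised to 2, where the excess is still 0.\<close>
  have mono: "hyp (real a) (real b) \<le> hyp (max 2 (real a)) (max 2 (real b))"
    by (intro hyp_mono) auto
  have "hyp 3 4 = 5" "hyp 4 3 = 5" "hyp 4 4 = sqrt 32" "hyp 2 4 = sqrt 20"
    by (simp_all add: hyp_def)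
  note num = this hyp_numerals
  have *: "a = 3 \<or> a = 4 \<or> a \<le> 2" "b = 3 \<or> b = 4 \<or> b \<le> 2"
    using assms by auto
  then show ?thesis
    using mono num sqrt_bounds by (auto simp: degree_excess_def max_def split: if_splits)
qed

section \<open>The Sombor index of a set of edges\<close>

text \<open>Degrees and index are computed from bare edge sets, so that composing a graph and
  deleting a leaf are plain set operations.\<close>

definition edge_degree :: "'a set set \<Rightarrow> 'a \<Rightarrow> nat" where
  "edge_degree E v = card {e \<in> E. v \<in> e}"

definition sombor :: "'a set set \<Rightarrow> real" where
  "sombor E = (\<Sum>e\<in>E. sqrt (\<Sum>v\<in>e. (real (edge_degree E v))\<^sup>2))"

lemma sqrt_sum_doubleton:
  "u \<noteq> v \<Longrightarrow> sqrt (\<Sum>w\<in>{u, v}. (real (g w))\<^sup>2) = hyp (real (g u)) (real (g v))"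
  by (simp add: hyp_def)

lemma sombor_eq_sum_hyp:
  assumes "\<And>x. x \<in> I \<Longrightarrow> u x \<noteq> v x" "inj_on (\<lambda>x. {u x, v x}) I"
  shows "(\<Sum>e\<in>(\<lambda>x. {u x, v x}) ` I. sqrt (\<Sum>w\<in>e. (real (g w))\<^sup>2))
    = (\<Sum>x\<in>I. hyp (real (g (u x))) (real (g (v x))))"
  using assms by (subst sum.reindex) (auto simp: hyp_def)

lemma edge_degree_Un:
  assumes "finite A" "finite B" "A \<inter> B = {}"
  shows "edge_degree (A \<union> B) v = edge_degree A v + edge_degree B v"
proof -
  have "{e \<in> A \<union> B. v \<in> e} = {e \<in> A. v \<in> e} \<union> {e \<in> B. v \<in> e}"
    by auto
  then show ?thesis
    unfolding edge_degree_def using assms by (simp add: card_Un_disjoint disjoint_iff)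
qed

lemma edge_degree_singleton: "edge_degree {e} v = (if v \<in> e then 1 else 0)"
proof -
  have "{e' \<in> {e}. v \<in> e'} = (if v \<in> e then {e} else {})"
    by auto
  then show ?thesis
    by (simp add: edge_degree_def)
qed

lemma edge_degree_eq_0: "v \<notin> \<Union>E \<Longrightarrow> edge_degree E v = 0"
proof -
  assume "v \<notin> \<Union>E"
  then have "{e \<in> E. v \<in> e} = {}"
    by auto
  then show ?thesis
    by (simp only: edge_degree_def card.empty)
qed

text \<open>The handshake lemma, by double counting of incidences.\<close>

lemma sum_edge_degree:
  assumes "finite V" "finite E" "\<And>e. e \<in> E \<Longrightarrow> e \<subseteq> V \<and> card e = 2"
  shows "(\<Sum>v\<in>V. edge_degree E v) = 2 * card E"
proof -
  have "(\<Sum>v\<in>V. edge_degree E v) = (\<Sum>v\<in>V. \<Sum>e\<in>E. if v \<in> e then 1 else 0)"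
    using assms(2) by (simp add: edge_degree_def flip: sum.inter_filter)
  also have "\<dots> = (\<Sum>e\<in>E. \<Sum>v\<in>V. if v \<in> e then 1 else 0)"
    by (rule sum.swap)
  also have "\<dots> = (\<Sum>e\<in>E. card e)"
  proof (rule sum.cong)
    fix e assume "e \<in> E"
    then have "{v \<in> V. v \<in> e} = e"
      using assms(3) by blast
    then show "(\<Sum>v\<in>V. if v \<in> e then 1 else 0) = card e"
      using assms(1) by (simp flip: sum.inter_filter)
  qed simp
  finally show ?thesis
    using assms(3) by simp
qed

lemma sombor_image:
  assumes "inj_on \<phi> (\<Union>E)"
  shows "sombor ((`) \<phi> ` E) = sombor E"
proof -
  have inj: "inj_on ((`) \<phi>) E"
    by (rule inj_on_subset[OF inj_on_image_Pow[OF assms]]) auto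
  have deg: "edge_degree ((`) \<phi> ` E) (\<phi> v) = edge_degree E v" if "v \<in> \<Union>E" for v
  proof -
    have "{e \<in> (`) \<phi> ` E. \<phi> v \<in> e} = (`) \<phi> ` {e \<in> E. v \<in> e}"
      using that assms by (auto dest!: inj_onD)
    moreover have "inj_on ((`) \<phi>) {e \<in> E. v \<in> e}"
      by (rule inj_on_subset[OF inj]) auto
    ultimately show ?thesis
      by (simp add: edge_degree_def card_image)
  qed
  have "(\<Sum>v\<in>\<phi> ` e. (real (edge_degree ((`) \<phi> ` E) v))\<^sup>2) = (\<Sum>v\<in>e. (real (edge_degree E v))\<^sup>2)"
    if "e \<in> E" for e
  proof -
    have "inj_on \<phi> e"
      by (rule inj_on_subset[OF assms]) (use that in auto)
    then show ?thesis
      by (simp add: sum.reindex deg[OF UnionI[OF that]])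
  qed
  then show "sombor ((`) \<phi> ` E) = sombor E"
    unfolding sombor_def by (subst sum.reindex[OF inj]) (simp cong: sum.cong)
qed

section \<open>Paths and stars as edge sets\<close>

definition path_edges :: "(nat \<Rightarrow> 'a) \<Rightarrow> nat \<Rightarrow> 'a set set" where
  "path_edges p d = (\<lambda>k. {p k, p (Suc k)}) ` {..<d}"

definition star_edges :: "'a \<Rightarrow> 'a set \<Rightarrow> 'a set set" where
  "star_edges c W = (\<lambda>w. {c, w}) ` W"

lemma inj_on_path_edge:
  assumes "inj_on p {..d}"
  shows "inj_on (\<lambda>k. {p k, p (Suc k)}) {..<d}"
proof (rule inj_onI)
  fix k l
  assume "k \<in> {..<d}" "l \<in> {..<d}" "{p k, p (Suc k)} = {p l, p (Suc l)}"
  then show "k = l"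
    using assms unfolding doubleton_eq_iff by (auto simp: inj_on_eq_iff)
qed

lemma card_path_edges: "inj_on p {..d} \<Longrightarrow> card (path_edges p d) = d"
  by (simp add: path_edges_def card_image inj_on_path_edge)

lemma card_star_edges: "c \<notin> W \<Longrightarrow> card (star_edges c W) = card W"
  unfolding star_edges_def by (rule card_image) (auto simp: inj_on_def doubleton_eq_iff)

lemma edge_degree_path_edges:
  assumes "inj_on p {..d}" "k \<le> d"
  shows "edge_degree (path_edges p d) (p k) = (if 0 < k then 1 else 0) + (if k < d then 1 else 0)"
proof -
  \<comment> \<open>The edges at \<open>p k\<close> have the numbers \<open>k\<close> and
    \<open>k - 1\<close>. The guard \<open>0 < k\<close> is needed because \<open>k - 1\<close> is
    truncated, and intersecting with \<open>{..<d}\<close> drops number \<open>d\<close>.\<close>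
  have "{e \<in> path_edges p d. p k \<in> e} =
      (\<lambda>k. {p k, p (Suc k)}) ` ({..<d} \<inter> ({k} \<union> (if 0 < k then {k - 1} else {})))"
  proof (intro equalityI subsetI)
    fix e assume "e \<in> {e \<in> path_edges p d. p k \<in> e}"
    then obtain l where l: "l < d" "e = {p l, p (Suc l)}" "p k = p l \<or> p k = p (Suc l)"
      by (auto simp: path_edges_def)
    then have "k = l \<or> k = Suc l"
      using assms by (auto dest!: inj_onD)
    then show "e \<in> (\<lambda>k. {p k, p (Suc k)}) ` ({..<d} \<inter> ({k} \<union> (if 0 < k then {k - 1} else {})))"
      using l by auto
  qed (auto simp: path_edges_def split: if_splits)
  moreover have "card \<dots> = card ({..<d} \<inter> ({k} \<union> (if 0 < k then {k - 1} else {})))"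
    by (rule card_image[OF inj_on_subset[OF inj_on_path_edge[OF assms(1)]]]) auto
  moreover have "\<dots> = (if 0 < k then 1 else 0) + (if k < d then 1 else 0)"
    using assms(2) by (auto simp: Int_insert_right)
  ultimately show ?thesis
    by (simp add: edge_degree_def)
qed

lemma edge_degree_star_edges:
  assumes "finite W" "c \<notin> W"
  shows "edge_degree (star_edges c W) v = (if v = c then card W else if v \<in> W then 1 else 0)"
proof -
  have "{e \<in> star_edges c W. v \<in> e} = (if v = c then star_edges c W else if v \<in> W then {{c, v}} else {})"
    by (auto simp: star_edges_def)
  then show ?thesis
    using assms by (simp add: edge_degree_def card_star_edges)
qed

lemma path_sum_end:
  fixes g :: "nat \<Rightarrow> nat"
  assumes "i < d" "g d = 1" "\<And>k. \<lbrakk>i < k; k < d\<rbrakk> \<Longrightarrow> g k = 2"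
  shows "(\<Sum>k=i..<d. hyp (g k) (g (Suc k))) = tail_weight (g i) (d - i)"
proof (cases "d = Suc i")
  case True
  then show ?thesis
    using assms by simp
next
  case False
  with assms(1) obtain d' where d: "d = Suc d'" "i < d'"
    by (cases d) auto
  have "(\<Sum>k=i..<d. hyp (g k) (g (Suc k)))
      = hyp (g i) (g (Suc i)) + (\<Sum>k=Suc i..<d'. hyp (g k) (g (Suc k))) + hyp (g d') (g d)"
    using d by (simp add: sum.atLeast_Suc_lessThan)
  also have "(\<Sum>k=Suc i..<d'. hyp (g k) (g (Suc k))) = (\<Sum>k=Suc i..<d'. sqrt 8)"
    using assms(3) d by (intro sum.cong) (auto simp: hyp_numerals)
  finally show ?thesis
    using assms(2) assms(3)[of "Suc i"] assms(3)[of d'] d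
    by (simp add: tail_weight_ge_2 hyp_numerals of_nat_diff)
qed

lemma path_sum_start:
  fixes g :: "nat \<Rightarrow> nat"
  assumes "0 < i" "g 0 = 1" "\<And>k. \<lbrakk>0 < k; k < i\<rbrakk> \<Longrightarrow> g k = 2"
  shows "(\<Sum>k<i. hyp (g k) (g (Suc k))) = tail_weight (g i) i"
proof -
  have "(\<Sum>k<i. hyp (g k) (g (Suc k))) = (\<Sum>k<i. hyp (g (i - Suc k)) (g (Suc (i - Suc k))))"
    by (rule sum.nat_diff_reindex[symmetric])
  also have "\<dots> = (\<Sum>k=0..<i. hyp (g (i - k)) (g (i - Suc k)))"
    unfolding lessThan_atLeast0 by (intro sum.cong) (auto simp: hyp_commute Suc_diff_Suc)
  also have "\<dots> = tail_weight (g i) i"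
    using path_sum_end[of 0 i "\<lambda>k. g (i - k)"] assms by simp
  finally show ?thesis .
qed

section \<open>A path with a star and one further edge\<close>

text \<open>The further edge is \<open>{a, b}\<close>. The centre \<open>p i\<close> is excluded for
  \<open>b\<close> because that edge already belongs to the star.\<close>

locale path_star_edge =
  fixes p :: "nat \<Rightarrow> 'a" and d i :: nat and W :: "'a set" and a b :: 'a
  assumes inj: "inj_on p {..d}" and i: "0 < i" "i < d" and d: "4 \<le> d"
    and W: "finite W" "W \<inter> p ` {..d} = {}" and a: "a \<in> W"
    and b: "b \<in> W - {a} \<union> p ` {..d} - {p i}"
begin

definition E where
  "E = path_edges p d \<union> star_edges (p i) W \<union> {{a, b}}"

lemma p_eq_iff: "\<lbrakk>k \<le> d; l \<le> d\<rbrakk> \<Longrightarrow> p k = p l \<longleftrightarrow> k = l"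
  using inj by (auto dest: inj_onD)

lemma p_notin_W: "k \<le> d \<Longrightarrow> p k \<notin> W"
  using W by auto

lemma disjoint_edges:
  "path_edges p d \<inter> star_edges (p i) W = {}" "{a, b} \<notin> path_edges p d" "{a, b} \<notin> star_edges (p i) W"
proof -
  show "path_edges p d \<inter> star_edges (p i) W = {}"
  proof -
    have "e \<inter> W = {}" if "e \<in> path_edges p d" for e
      using that p_notin_W by (auto simp: path_edges_def)
    moreover have "e \<inter> W \<noteq> {}" if "e \<in> star_edges (p i) W" for e
      using that by (auto simp: star_edges_def)
    ultimately show ?thesis
      by blast
  qed
  show "{a, b} \<notin> path_edges p d"
    using a p_notin_W by (auto simp: path_edges_def doubleton_eq_iff)
  show "{a, b} \<notin> star_edges (p i) W"
    using b i p_notin_W[of i] a by (auto simp: star_edges_def doubleton_eq_iff)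
qed

lemma finite_edges: "finite (path_edges p d)" "finite (star_edges (p i) W)"
  using W by (auto simp: path_edges_def star_edges_def)

lemma a_neq_b: "a \<noteq> b"
  using a b W by auto

lemma edge_degree_E:
  "edge_degree E v = edge_degree (path_edges p d) v
    + (if v = p i then card W else if v \<in> W then 1 else 0) + (if v \<in> {a, b} then 1 else 0)"
proof -
  have "edge_degree E v = edge_degree (path_edges p d) v + edge_degree (star_edges (p i) W) v
      + edge_degree {{a, b}} v"
    unfolding E_def using finite_edges disjoint_edges
    by (subst edge_degree_Un; simp del: Un_insert_right) (simp add: edge_degree_Un)
  then show ?thesis
    using W i p_notin_W[of i] by (simp add: edge_degree_star_edges edge_degree_singleton)
qed

lemma edge_degree_path:
  "k \<le> d \<Longrightarrow> edge_degree E (p k) = (if 0 < k then 1 else 0) + (if k < d then 1 else 0)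
    + (if k = i then card W else 0) + (if p k = b then 1 else 0)"
  using p_notin_W[of k] a i
  by (auto simp: edge_degree_E edge_degree_path_edges[OF inj] p_eq_iff)

lemma edge_degree_W:
  "w \<in> W \<Longrightarrow> edge_degree E w = (if w \<in> {a, b} then 2 else 1)"
proof -
  assume w: "w \<in> W"
  then have "w \<notin> \<Union> (path_edges p d)" "w \<noteq> p i"
    using p_notin_W i by (auto simp: path_edges_def)
  with w show ?thesis
    by (auto simp: edge_degree_E edge_degree_eq_0)
qed

lemma sombor_E:
  "sombor E = (\<Sum>k<d. hyp (edge_degree E (p k)) (edge_degree E (p (Suc k))))
    + (\<Sum>w\<in>W. hyp (edge_degree E (p i)) (edge_degree E w)) + hyp (edge_degree E a) (edge_degree E b)"
proof -
  let ?w = "\<lambda>e. sqrt (\<Sum>v\<in>e. (real (edge_degree E v))\<^sup>2)"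
  have "sombor E = sum ?w (path_edges p d) + sum ?w (star_edges (p i) W) + ?w {a, b}"
    unfolding sombor_def using finite_edges disjoint_edges
    by (subst E_def) (simp add: sum.union_disjoint)
  also have "sum ?w (path_edges p d)
      = (\<Sum>k<d. hyp (edge_degree E (p k)) (edge_degree E (p (Suc k))))"
    unfolding path_edges_def using inj_on_path_edge[OF inj]
    by (intro sombor_eq_sum_hyp) (auto simp: p_eq_iff)
  also have "sum ?w (star_edges (p i) W) = (\<Sum>w\<in>W. hyp (edge_degree E (p i)) (edge_degree E w))"
    unfolding star_edges_def using p_notin_W[of i] i
    by (intro sombor_eq_sum_hyp) (auto simp: inj_on_def doubleton_eq_iff)
  finally show ?thesis
    by (simp only: sqrt_sum_doubleton[OF a_neq_b])
qed

lemma card_W_pos: "0 < card W"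
  using W a by (auto simp: card_gt_0_iff)

lemma edge_degree_center: "edge_degree E (p i) = card W + 2"
  using i b by (auto simp: edge_degree_path)

lemma start_sum:
  assumes "\<And>k. k < i \<Longrightarrow> b \<noteq> p k"
  shows "(\<Sum>k<i. hyp (edge_degree E (p k)) (edge_degree E (p (Suc k)))) = tail_weight (card W + 2) i"
proof -
  have "edge_degree E (p k) = (if k = 0 then 1 else 2)" if "k < i" for k
    using that i assms[OF that] by (subst edge_degree_path) auto
  then show ?thesis
    using path_sum_start[of i "\<lambda>k. edge_degree E (p k)"] i by (simp add: edge_degree_center)
qed

lemma sum_split:
  fixes g :: "nat \<Rightarrow> real"
  assumes "k \<le> l"
  shows "(\<Sum>j<l. g j) = (\<Sum>j<k. g j) + (\<Sum>j=k..<l. g j)"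
  using sum.atLeastLessThan_concat[of 0 k l g] assms by (simp add: lessThan_atLeast0)

lemma star_sum_single:
  assumes "b \<notin> W"
  shows "(\<Sum>w\<in>W. hyp (edge_degree E (p i)) (edge_degree E w))
    = hyp (card W + 2) 2 + (real (card W) - 1) * hyp (card W + 2) 1"
proof -
  have "(\<Sum>w\<in>W - {a}. hyp (edge_degree E (p i)) (edge_degree E w)) = (\<Sum>w\<in>W - {a}. hyp (card W + 2) 1)"
    using assms by (intro sum.cong) (auto simp: edge_degree_W edge_degree_center)
  then show ?thesis
    using W a card_W_pos
    by (simp add: sum.remove edge_degree_W edge_degree_center of_nat_diff card_Diff_singleton)
qed

lemma sombor_two_in_W:
  assumes "b \<in> W"
  shows "sombor E < extremal_value (card W) d"
proof -
  have "p k \<noteq> b" if "k \<le> d" for k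
    using assms that p_notin_W by auto
  moreover from this have "(\<Sum>k=i..<d. hyp (edge_degree E (p k)) (edge_degree E (p (Suc k))))
      = tail_weight (edge_degree E (p i)) (d - i)"
    using i by (intro path_sum_end) (fastforce simp: edge_degree_path)+
  moreover have "(\<Sum>k<i. hyp (edge_degree E (p k)) (edge_degree E (p (Suc k)))) = tail_weight (card W + 2) i"
    using \<open>\<And>k. k \<le> d \<Longrightarrow> p k \<noteq> b\<close> i by (intro start_sum) (metis less_imp_le less_trans)
  ultimately have "(\<Sum>k<d. hyp (edge_degree E (p k)) (edge_degree E (p (Suc k))))
      = tail_weight (card W + 2) i + tail_weight (card W + 2) (d - i)"
    using sum_split[of i d "\<lambda>k. hyp (edge_degree E (p k)) (edge_degree E (p (Suc k)))"] i
    by (simp add: edge_degree_center)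
  moreover have "(\<Sum>w\<in>W. hyp (edge_degree E (p i)) (edge_degree E w))
    = 2 * hyp (card W + 2) 2 + (real (card W) - 2) * hyp (card W + 2) 1"
  proof -
    have "(\<Sum>w\<in>W - {a, b}. hyp (edge_degree E (p i)) (edge_degree E w))
        = (\<Sum>w\<in>W - {a, b}. hyp (card W + 2) 1)"
      by (intro sum.cong) (auto simp: edge_degree_W edge_degree_center)
    moreover have "card W \<ge> 2"
      using card_mono[of W "{a, b}"] W a assms a_neq_b by simp
    moreover have "card (W - {a, b}) = card W - 2"
      using a assms a_neq_b by (subst card_Diff_subset) auto
    moreover have "(\<Sum>w\<in>W. hyp (edge_degree E (p i)) (edge_degree E w))
      = (\<Sum>w\<in>W - {a, b}. hyp (edge_degree E (p i)) (edge_degree E w))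
        + (\<Sum>w\<in>{a, b}. hyp (edge_degree E (p i)) (edge_degree E w))"
      using W a assms by (intro sum.subset_diff) auto
    ultimately show ?thesis
      using a assms a_neq_b by (simp add: edge_degree_W edge_degree_center of_nat_diff)
  qed
  moreover have "hyp (edge_degree E a) (edge_degree E b) = sqrt 8"
    using a assms by (simp add: edge_degree_W hyp_numerals)
  moreover have "tail_weight (card W + 2) i + tail_weight (card W + 2) (d - i)
    \<le> hyp (card W + 2) 1 + hyp (card W + 2) 2 + (real d - 3) * sqrt 8 + sqrt 5"
    using tail_weight_merge_same[of "real (card W + 2)" i "d - i"] i d card_W_pos by simp
  ultimately show ?thesis
    using extremal_value_gt_no_branch[of "card W" d] card_W_pos d
    by (simp add: sombor_E algebra_simps)
qed

text \<open>The sum splits into the tail before the centre, the stretch from \<open>p i\<close> to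
  \<open>p j\<close>, and the tail behind \<open>p j\<close>. Only \<open>b\<close> behind the
  centre is considered; the other direction follows by reversing the path. The second equality case
  is the mirror image: for \<open>card W = 1\<close> both \<open>p i\<close> and \<open>p j\<close>
  have degree 3.\<close>

lemma
  assumes "b = p j" "i < j" "j \<le> d" "j \<le> i + 2"
  shows sombor_forward_le: "sombor E \<le> extremal_value (card W) d"
    and sombor_forward_eq: "sombor E = extremal_value (card W) d \<Longrightarrow>
      j = i + 2 \<and> (i = 1 \<or> card W = 1 \<and> j + 1 = d)"
proof -
  let ?D = "real (card W + 2)" and ?g = "\<lambda>k. edge_degree E (p k)"
  have D: "3 \<le> ?D" "1 \<le> card W"
    using card_W_pos by auto
  have g: "?g k = (if 0 < k then 1 else 0) + (if k < d then 1 else 0)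
    + (if k = i then card W else 0) + (if k = j then 1 else 0)" if "k \<le> d" for k
    using edge_degree_path[OF that] p_eq_iff[OF that assms(3)] assms(1) by simp
  have "b \<notin> W"
    using assms p_notin_W by auto
  have start: "(\<Sum>k<i. hyp (?g k) (?g (Suc k))) = tail_weight ?D i"
    using start_sum p_eq_iff assms by fastforce
  have ab: "hyp (edge_degree E a) (edge_degree E b) = hyp 2 (?g j)"
    unfolding edge_degree_W[OF a] assms(1)[symmetric] by simp
  define mid where "mid = (\<Sum>k=i..<j. hyp (?g k) (?g (Suc k)))"
  define rest where "rest = (\<Sum>k=j..<d. hyp (?g k) (?g (Suc k)))"
  have split: "(\<Sum>k<d. hyp (?g k) (?g (Suc k))) = tail_weight ?D i + mid + rest"
    using sum_split[of i d] sum.atLeastLessThan_concat[of i j d "\<lambda>k. hyp (?g k) (?g (Suc k))"] assms i start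
    unfolding mid_def rest_def by simp
  have total: "sombor E = tail_weight ?D i + mid + rest + hyp ?D 2 + (real (card W) - 1) * hyp ?D 1
      + hyp 2 (?g j)"
    unfolding sombor_E split star_sum_single[OF \<open>b \<notin> W\<close>] ab by simp
  have "sombor E \<le> extremal_value (card W) d \<and> (sombor E = extremal_value (card W) d \<longrightarrow>
      j = i + 2 \<and> (i = 1 \<or> card W = 1 \<and> j + 1 = d))"
  proof (cases "j < d")
    case True
    have gj: "?g j = 3"
      using True assms g[of j] by simp
    have rest: "rest = tail_weight 3 (d - j)"
    proof -
      have "rest = tail_weight (?g j) (d - j)"
        unfolding rest_def using True assms(2) by (intro path_sum_end) (simp_all add: g)
      then show ?thesis
        by (simp add: gj)
    qed
    consider "j = i + 1" | "j = i + 2"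
      using assms by linarith
    then show ?thesis
    proof cases
      case 1
      then have "mid = hyp ?D 3"
        unfolding mid_def using gj i by (simp add: edge_degree_center)
      moreover have "tail_weight ?D i + tail_weight 3 (d - j) \<le> hyp ?D 1 + tail_weight 3 (d - 2)"
      proof -
        have "d - 2 = i + (d - j) - 1"
          using 1 True by simp
        then show ?thesis
          using tail_weight_merge(1)[OF D(1), of i "d - j"] True i by simp
      qed
      ultimately show ?thesis
        using total rest gj extremal_value_gt_triangle[of "card W" d] D d
        by (simp add: hyp_numerals algebra_simps)
    next
      case 2
      then have "{i..<j} = {i, Suc i}"
        by auto
      then have mid: "mid = hyp ?D 2 + sqrt 13"
        unfolding mid_def using gj i 2 True g[of "Suc i"]
        by (simp add: edge_degree_center hyp_numerals)
      have eq: "d - 3 = i + (d - j) - 1"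
        using 2 True i by simp
      have "1 \<le> i" "1 \<le> d - j"
        using i True by auto
      note merge = tail_weight_merge[OF D(1) this]
      \<comment> \<open>The 4-cycle terms cancel exactly, so the inequality and its equality cases
        are those of merging the two tails.\<close>
      have "sombor E - extremal_value (card W) d
        = tail_weight ?D i + tail_weight 3 (d - j) - (hyp ?D 1 + tail_weight 3 (i + (d - j) - 1))"
        unfolding extremal_value_def eq using total rest gj mid
        by (simp add: hyp_numerals algebra_simps)
      then show ?thesis
        using merge i True 2 by force
    qed
  next
    \<comment> \<open>The further edge closes at the end of the path: \<open>p d\<close> gets degree
      2, no tail is left behind it, and no second branch vertex arises.\<close>
    case False
    with assms have j: "j = d"
      by simp
    then have gj: "?g j = 2"
      using assms g[of j] by simp
    have rest: "rest = 0"
      unfolding rest_def j by simp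
    have ti: "tail_weight ?D i = hyp ?D 2 + (real i - 2) * sqrt 8 + sqrt 5"
      using assms j d by (intro tail_weight_ge_2) simp
    consider "d = i + 1" | "d = i + 2"
      using assms j by linarith
    then have "mid = hyp ?D 2 + (real (d - i) - 1) * sqrt 8"
    proof cases
      case 1
      then have "mid = hyp (?g i) (?g j)"
        unfolding mid_def using j by simp
      moreover have "real (d - i) - 1 = 0"
        using 1 by simp
      ultimately show ?thesis
        using gj by (simp only: edge_degree_center) simp
    next
      case 2
      then have "{i..<j} = {i, Suc i}"
        using j by auto
      then have "mid = hyp (?g i) (?g (Suc i)) + hyp (?g (Suc i)) (?g j)"
        unfolding mid_def using 2 j by simp
      moreover have "?g (Suc i) = 2" "real (d - i) - 1 = 1"
        using 2 i g[of "Suc i"] j by simp_all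
      ultimately show ?thesis
        using gj by (simp only: edge_degree_center) (simp add: hyp_numerals)
    qed
    then have "sombor E = (real (card W) - 1) * hyp ?D 1 + 3 * hyp ?D 2 + (real d - 2) * sqrt 8 + sqrt 5"
      using total rest ti gj i by (simp add: hyp_numerals algebra_simps of_nat_diff)
    then show ?thesis
      using extremal_value_gt_no_branch[of "card W" d] D d by simp
  qed
  then show "sombor E \<le> extremal_value (card W) d"
    and "sombor E = extremal_value (card W) d \<Longrightarrow> j = i + 2 \<and> (i = 1 \<or> card W = 1 \<and> j + 1 = d)"
    by auto
qed

lemma sombor_extremal:
  assumes "i = 1" "b = p 3"
  shows "sombor E = extremal_value (card W) d"
proof -
  let ?g = "\<lambda>k. edge_degree E (p k)"
  have g: "?g k = (if 0 < k then 1 else 0) + (if k < d then 1 else 0)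
    + (if k = 1 then card W else 0) + (if k = 3 then 1 else 0)" if "k \<le> d" for k
    using edge_degree_path[OF that] p_eq_iff[OF that, of 3] assms d by simp
  have "b \<notin> W"
    using assms p_notin_W d by auto
  moreover have "(\<Sum>k<d. hyp (?g k) (?g (Suc k))) = (\<Sum>k<3. hyp (?g k) (?g (Suc k))) + tail_weight 3 (d - 3)"
  proof -
    have "(\<Sum>k=3..<d. hyp (?g k) (?g (Suc k))) = tail_weight (?g 3) (d - 3)"
      using d by (intro path_sum_end) (simp_all add: g)
    then show ?thesis
      using sum_split[of 3 d] d by (simp add: g)
  qed
  moreover have "(\<Sum>k<3. hyp (?g k) (?g (Suc k))) = hyp 1 (card W + 2) + hyp (card W + 2) 2 + sqrt 13"
    using d by (simp add: numeral_3_eq_3 g hyp_numerals)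
  moreover have "hyp (edge_degree E a) (edge_degree E b) = sqrt 13"
    using d g[of 3] unfolding edge_degree_W[OF a] assms(2)[symmetric] by (simp add: hyp_numerals)
  ultimately show ?thesis
    unfolding sombor_E extremal_value_def 
    by (simp add: star_sum_single hyp_commute[of 1] algebra_simps)
qed

end

text \<open>The graph \<open>U_n^d\<close> up to labels, with indices shifted by one:
  \<open>p k\<close> is \<open>u_(k+1)\<close>, so \<open>p 1\<close> and \<open>p 3\<close> are
  \<open>u_2\<close> and \<open>u_4\<close>. The vertex \<open>a\<close> is \<open>w\<close>, and
  the rest of \<open>W\<close> are the further pendent vertices.\<close>

definition extremal_shape :: "'a set \<Rightarrow> 'a set set \<Rightarrow> nat \<Rightarrow> bool" where
  "extremal_shape V E d \<longleftrightarrow> (\<exists>p W a. inj_on p {..d} \<and> finite W \<and> W \<inter> p ` {..d} = {} \<and> a \<in> W \<and>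
     V = p ` {..d} \<union> W \<and> E = path_edges p d \<union> star_edges (p 1) W \<union> {{a, p 3}})"

section \<open>Reversing the path\<close>

lemma path_edges_reverse: "path_edges (\<lambda>k. p (d - k)) d = path_edges p d"
proof -
  have "path_edges (\<lambda>k. p (d - k)) d = (\<lambda>k. {p k, p (Suc k)}) ` (\<lambda>k. d - Suc k) ` {..<d}"
    unfolding path_edges_def image_image by (intro image_cong) (auto simp: Suc_diff_Suc insert_commute)
  also have "(\<lambda>k. d - Suc k) ` {..<d} = {..<d}"
  proof (intro equalityI subsetI)
    fix k assume "k \<in> {..<d}"
    then show "k \<in> (\<lambda>k. d - Suc k) ` {..<d}"
      by (intro image_eqI[of _ _ "d - Suc k"]) auto
  qed auto
  finally show ?thesis
    by (simp add: path_edges_def)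
qed

lemma image_reverse: "(\<lambda>k. p (d - k)) ` {..d} = p ` {..(d::nat)}"
proof (intro equalityI subsetI)
  fix x assume "x \<in> p ` {..d}"
  then obtain k where "k \<le> d" "x = p k"
    by auto
  then show "x \<in> (\<lambda>k. p (d - k)) ` {..d}"
    by (intro image_eqI[of _ _ "d - k"]) auto
qed auto

lemma inj_on_reverse: "inj_on p {..d} \<Longrightarrow> inj_on (\<lambda>k. p (d - k)) {..(d::nat)}"
  by (rule inj_onI) (metis atMost_iff diff_diff_cancel diff_le_self inj_onD)

context path_star_edge
begin

lemma forward_shape:
  assumes "b = p j" "i < j" "j \<le> d" "j \<le> i + 2" "sombor E = extremal_value (card W) d"
  shows "extremal_shape (p ` {..d} \<union> W) E d"
proof -
  have j: "j = i + 2" and "i = 1 \<or> card W = 1 \<and> j + 1 = d"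
    using sombor_forward_eq assms by auto
  then consider "i = 1" | "card W = 1" "j + 1 = d"
    by auto
  then show ?thesis
  proof cases
    case 1
    then have "E = path_edges p d \<union> star_edges (p 1) W \<union> {{a, p 3}}"
      unfolding E_def using j assms(1) by (simp add: numeral_3_eq_3)
    then show ?thesis
      unfolding extremal_shape_def using inj W a by blast
  next
    case 2
    then have "W = {a}"
      using a by (auto simp: card_1_singleton_iff)
    \<comment> \<open>Read backwards, \<open>p j\<close> and \<open>p i\<close> are at positions 1
      and 3. As \<open>W = {a}\<close>, the single star edge and the further edge exchange their
      roles.\<close>
    let ?q = "\<lambda>k. p (d - k)"
    have "d - 1 = j" "d - 3 = i"
      using 2 j by auto
    then have "E = path_edges ?q d \<union> star_edges (?q 1) W \<union> {{a, ?q 3}}"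
      unfolding E_def path_edges_reverse using assms(1) \<open>W = {a}\<close>
      by (simp add: star_edges_def insert_commute)
    then show ?thesis
      unfolding extremal_shape_def using inj_on_reverse[OF inj] image_reverse[of p d] W a by metis
  qed
qed

end

lemma star_on_path_bound:
  assumes "inj_on p {..d}" "0 < i" "i < d" "4 \<le> d" "finite W" "W \<inter> p ` {..d} = {}" "a \<in> W"
    and b: "b \<in> W - {a} \<or> (\<exists>j\<le>d. b = p j \<and> j \<noteq> i \<and> j \<le> i + 2 \<and> i \<le> j + 2)"
    and E: "E = path_edges p d \<union> star_edges (p i) W \<union> {{a, b}}"
    and V: "V = p ` {..d} \<union> W"
  shows "sombor E \<le> extremal_value (card W) d \<and>
    (sombor E = extremal_value (card W) d \<longrightarrow> extremal_shape V E d)"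
proof -
  have bi: "b \<in> W - {a} \<union> p ` {..d} - {p i}"
    using b assms(1,3,6) by (auto simp: inj_on_eq_iff)
  interpret P: path_star_edge p d i W a b
    using assms bi by unfold_locales auto
  let ?q = "\<lambda>k. p (d - k)"
  \<comment> \<open>The reversed path describes the same edge set, but \<open>b\<close> now lies
    behind the centre if it lay before it.\<close>
  interpret Q: path_star_edge ?q d "d - i" W a b
    using assms bi inj_on_reverse[OF assms(1)] image_reverse[of p d] by unfold_locales auto
  have PE: "P.E = E"
    by (simp add: P.E_def E)
  have QE: "Q.E = E"
    using assms(3) by (simp add: Q.E_def E path_edges_reverse)
  consider "b \<in> W" | j where "b = p j" "i < j" "j \<le> d" "j \<le> i + 2"
    | j where "b = p j" "j < i" "j \<le> d" "i \<le> j + 2"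
    using b by (metis DiffD1 nat_neq_iff)
  then show ?thesis
  proof cases
    case 1
    then show ?thesis
      using P.sombor_two_in_W by (simp add: PE)
  next
    case 2
    show ?thesis
      using P.sombor_forward_le[OF 2] P.forward_shape[OF 2] unfolding PE V by blast
  next
    case 3
    then have q: "b = ?q (d - j)" "d - i < d - j" "d - j \<le> d" "d - j \<le> d - i + 2"
      using assms(3) by auto
    show ?thesis
      using Q.sombor_forward_le[OF q] Q.forward_shape[OF q] unfolding QE V image_reverse by blast
  qed
qed

section \<open>Removing a leaf\<close>

lemma edge_degree_Diff_singleton:
  assumes "finite E" "e \<in> E"
  shows "edge_degree E x = edge_degree (E - {e}) x + (if x \<in> e then 1 else 0)"
  using edge_degree_Un[of "E - {e}" "{e}" x] assms
  by (simp add: edge_degree_singleton insert_absorb)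

lemma edge_degree_pos: "\<lbrakk>finite E; e \<in> E; x \<in> e\<rbrakk> \<Longrightarrow> 1 \<le> edge_degree E x"
  unfolding edge_degree_def by (simp add: Suc_le_eq card_gt_0_iff) blast

text \<open>Apart from the lost edge, only the \<open>s\<close> remaining edges at \<open>u\<close>
  change. Raising the degree of \<open>u\<close> adds most to an edge whose other end has the least
  degree, which is at least 1; hence the increment of a leaf edge bounds each change.\<close>

lemma sombor_remove_leaf:
  assumes "finite E" "\<And>e. e \<in> E \<Longrightarrow> card e = 2" "u \<noteq> v" "{e \<in> E. v \<in> e} = {{u, v}}"
    and s: "edge_degree E u = Suc s"
  shows "sombor E \<le> sombor (E - {{u, v}}) + hyp (real s + 1) 1
    + real s * (hyp (real s + 1) 1 - hyp (real s) 1)"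
proof -
  define E' where "E' = E - {{u, v}}"
  have uv: "{u, v} \<in> E"
    using assms(4) by auto
  have deg: "edge_degree E x = edge_degree E' x" if "x \<noteq> u" "x \<noteq> v" for x
    using edge_degree_Diff_singleton[OF assms(1) uv, of x] that by (simp add: E'_def)
  have degu: "edge_degree E' u = s"
    using edge_degree_Diff_singleton[OF assms(1) uv, of u] s by (simp add: E'_def)
  let ?w = "\<lambda>E e. sqrt (\<Sum>v\<in>e. (real (edge_degree E v))\<^sup>2)"
  let ?c = "hyp (real s + 1) 1 - hyp (real s) 1"
  have le: "?w E e \<le> ?w E' e + (if u \<in> e then ?c else 0)" if e: "e \<in> E'" for e
  proof -
    have "v \<notin> e"
      using e assms(4) by (auto simp: E'_def)
    show ?thesis
    proof (cases "u \<in> e")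
      case True
      have "card e = 2"
        using e assms(2) by (auto simp: E'_def)
      then obtain y where y: "e = {u, y}" "u \<noteq> y"
        using True by (auto simp: card_2_iff)
      have "finite E'"
        using assms(1) by (simp add: E'_def)
      then have "1 \<le> edge_degree E' y" "1 \<le> s"
        using e y edge_degree_pos[of E' e] degu by auto
      then have "hyp (edge_degree E' y) (s + 1) - hyp (edge_degree E' y) s \<le> hyp 1 (s + 1) - hyp 1 s"
        by (intro hyp_diff_antimono) auto
      moreover have "edge_degree E y = edge_degree E' y"
        using y \<open>v \<notin> e\<close> by (intro deg) auto
      moreover have "?w E e = hyp (edge_degree E u) (edge_degree E y)"
        "?w E' e = hyp (edge_degree E' u) (edge_degree E' y)"
        unfolding y(1) by (rule sqrt_sum_doubleton[OF y(2)])+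
      ultimately show ?thesis
        using True s degu by (simp add: hyp_commute add.commute)
    next
      case False
      have "(\<Sum>x\<in>e. (real (edge_degree E x))\<^sup>2) = (\<Sum>x\<in>e. (real (edge_degree E' x))\<^sup>2)"
        using False \<open>v \<notin> e\<close> by (intro sum.cong refl arg_cong[where f = "\<lambda>n. (real n)\<^sup>2"] deg) auto
      with False show ?thesis
        by simp
    qed
  qed
  have "finite E'"
    using assms(1) by (simp add: E'_def)
  have "edge_degree E v = 1"
    using assms(4) by (simp add: edge_degree_def)
  then have "?w E {u, v} = hyp (real s + 1) 1"
    using sqrt_sum_doubleton[OF assms(3), of "edge_degree E"] s by (simp only: of_nat_Suc) (simp add: add.commute)
  moreover have "sombor E = ?w E {u, v} + (\<Sum>e\<in>E'. ?w E e)"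
    unfolding sombor_def E'_def using assms(1) uv by (rule sum.remove)
  moreover have "(\<Sum>e\<in>E'. ?w E e) \<le> (\<Sum>e\<in>E'. ?w E' e + (if u \<in> e then ?c else 0))"
    by (rule sum_mono) (rule le)
  moreover have "\<dots> = sombor E' + real s * ?c"
    using \<open>finite E'\<close> degu
    by (simp add: sum.distrib sombor_def edge_degree_def flip: sum.inter_filter)
  ultimately show ?thesis
    unfolding E'_def by linarith
qed

section \<open>Unicyclic graphs with a diametral path\<close>

text \<open>Of the graph only the following is used: it has as many edges as vertices, the path \<open>p\<close>
  is chordless, the neighbours on \<open>p\<close> of an outer vertex are at most two apart, and every set of
  outer vertices is joined to its complement. Unlike the diameter itself, these properties survive the
  removal of a leaf outside \<open>p\<close>.\<close>

locale path_graph =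
  fixes V :: "'a set" and E :: "'a set set" and p :: "nat \<Rightarrow> 'a" and d :: nat
  assumes finite_V: "finite V"
    and E: "e \<in> E \<Longrightarrow> e \<subseteq> V \<and> card e = 2"
    and card_E: "card E = card V"
    and d: "4 \<le> d"
    and inj: "inj_on p {..d}"
    and p_in_V: "p ` {..d} \<subseteq> V"
    and path_E: "path_edges p d \<subseteq> E"
    and chordless: "\<lbrakk>k \<le> d; l \<le> d; {p k, p l} \<in> E\<rbrakk> \<Longrightarrow> k \<le> l + 1"
    and close: "\<lbrakk>w \<in> V - p ` {..d}; k \<le> d; l \<le> d; {w, p k} \<in> E; {w, p l} \<in> E\<rbrakk> \<Longrightarrow> k \<le> l + 2"
    and cut: "\<lbrakk>S \<subseteq> V - p ` {..d}; S \<noteq> {}\<rbrakk> \<Longrightarrow> \<exists>x\<in>S. \<exists>y\<in>V - S. {x, y} \<in> E"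
begin

abbreviation P where "P \<equiv> p ` {..d}"
abbreviation W where "W \<equiv> V - P"
abbreviation N where "N \<equiv> E - path_edges p d"

lemma finite_E: "finite E"
  using E finite_V by (intro finite_subset[of E "Pow V"]) auto

lemma finite_W: "finite W"
  using finite_V by simp

lemma card_P: "card P = d + 1"
  using inj by (simp add: card_image)

lemma card_V: "card V = card W + d + 1"
  using card_Diff_subset[OF _ p_in_V] card_P card_mono[OF finite_V p_in_V] by simp

lemma card_N: "card N = card W + 1"
  using card_Diff_subset[OF _ path_E] finite_E path_E card_path_edges[OF inj] card_E card_V
  by (simp add: finite_subset)

lemma p_eq_iff: "\<lbrakk>k \<le> d; l \<le> d\<rbrakk> \<Longrightarrow> p k = p l \<longleftrightarrow> k = l"
  using inj by (simp add: inj_on_eq_iff)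

text \<open>By \<open>chordless\<close>, used in both directions, an edge with both ends on the path
  joins consecutive vertices and so is a path edge.\<close>

lemma N_meets_W:
  assumes "e \<in> N"
  obtains a b where "e = {a, b}" "a \<in> W" "b \<in> V" "a \<noteq> b"
proof -
  have "\<not> e \<subseteq> P"
  proof
    assume "e \<subseteq> P"
    moreover have "card e = 2"
      using E assms by auto
    ultimately obtain x y where xy: "e = {x, y}" "x \<noteq> y" "x \<in> P" "y \<in> P"
      by (auto simp: card_2_iff)
    then obtain k l where "k \<le> d" "x = p k" "l \<le> d" "y = p l"
      by blast
    with xy have kl: "k \<le> d" "l \<le> d" "e = {p k, p l}" "k \<noteq> l"
      by auto
    with assms have "k \<le> l + 1" "l \<le> k + 1"
      using chordless[of k l] chordless[of l k] by (auto simp: insert_commute)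
    with kl have "l = Suc k \<and> k < d \<or> k = Suc l \<and> l < d"
      by auto
    with kl have "e \<in> path_edges p d"
      by (auto simp: path_edges_def insert_commute)
    with assms show False
      by simp
  qed
  moreover have "card e = 2" "e \<subseteq> V"
    using E assms by auto
  ultimately obtain x y where xy: "e = {x, y}" "x \<noteq> y" "x \<in> V" "y \<in> V" "x \<notin> P \<or> y \<notin> P"
    by (auto simp: card_2_iff)
  then show ?thesis
    using that[of x y] that[of y x] by (auto simp: insert_commute)
qed

lemma path_edges_subset_P: "e \<in> path_edges p d \<Longrightarrow> e \<subseteq> P"
  by (auto simp: path_edges_def)

lemma edge_degree_split: "edge_degree E x = edge_degree (path_edges p d) x + edge_degree N x"
proof -
  have "E = path_edges p d \<union> N"
    using path_E by auto
  then show ?thesis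
    using edge_degree_Un[of "path_edges p d" N x] finite_E path_E by (auto dest: finite_subset)
qed

lemma edge_degree_W: "x \<in> W \<Longrightarrow> edge_degree E x = edge_degree N x"
  using edge_degree_split[of x] edge_degree_eq_0[of x "path_edges p d"] path_edges_subset_P by auto

lemma edge_degree_P_le:
  assumes "k \<le> d"
  shows "edge_degree N (p k) \<le> card {w \<in> W. {p k, w} \<in> E}"
proof -
  have "{e \<in> N. p k \<in> e} \<subseteq> (\<lambda>w. {p k, w}) ` {w \<in> W. {p k, w} \<in> E}"
  proof
    fix e assume e: "e \<in> {e \<in> N. p k \<in> e}"
    then obtain a b where "e = {a, b}" "a \<in> W"
      using N_meets_W by blast
    moreover have "p k \<noteq> a"
      using \<open>a \<in> W\<close> assms by auto
    ultimately show "e \<in> (\<lambda>w. {p k, w}) ` {w \<in> W. {p k, w} \<in> E}"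
      using e by (auto simp: insert_commute)
  qed
  then have "card {e \<in> N. p k \<in> e} \<le> card ((\<lambda>w. {p k, w}) ` {w \<in> W. {p k, w} \<in> E})"
    using finite_W by (intro card_mono) auto
  also have "\<dots> \<le> card {w \<in> W. {p k, w} \<in> E}"
    using finite_W by (intro card_image_le) auto
  finally show ?thesis
    by (simp add: edge_degree_def)
qed

lemma edge_degree_W_pos: "w \<in> W \<Longrightarrow> 1 \<le> edge_degree E w"
  using cut[of "{w}"] edge_degree_pos[OF finite_E] by auto

lemma star_bound:
  assumes "W \<noteq> {}" "0 < i" "i < d" "\<And>w. w \<in> W \<Longrightarrow> {p i, w} \<in> E"
  shows "sombor E \<le> extremal_value (card W) d \<and>
    (sombor E = extremal_value (card W) d \<longrightarrow> extremal_shape V E d)"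
proof -
  have piW: "p i \<notin> W"
    using assms(3) by auto
  have sub: "star_edges (p i) W \<subseteq> N"
    using assms(4) path_edges_subset_P by (auto simp: star_edges_def)
  then have "card (N - star_edges (p i) W) = 1"
    using card_Diff_subset[OF _ sub] finite_E card_star_edges[OF piW] card_N by (auto dest: finite_subset)
  then obtain e where e: "N - star_edges (p i) W = {e}"
    by (auto simp: card_1_singleton_iff)
  then have eN: "e \<in> N" "e \<notin> star_edges (p i) W"
    by auto
  then obtain a b where ab: "e = {a, b}" "a \<in> W" "b \<in> V" "a \<noteq> b"
    using N_meets_W by blast
  have b: "b \<in> W - {a} \<or> (\<exists>j\<le>d. b = p j \<and> j \<noteq> i \<and> j \<le> i + 2 \<and> i \<le> j + 2)"
  proof (cases "b \<in> W")
    case False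
    then obtain j where j: "j \<le> d" "b = p j"
      using ab by auto
    have "j \<noteq> i"
      using eN ab j by (auto simp: star_edges_def insert_commute)
    moreover have "{a, p j} \<in> E" "{a, p i} \<in> E"
      using eN ab j assms(4)[of a] by (auto simp: insert_commute)
    then have "j \<le> i + 2" "i \<le> j + 2"
      using close[OF ab(2)] j assms(3) by auto
    ultimately show ?thesis
      using j by auto
  qed (use ab in auto)
  have "E = path_edges p d \<union> star_edges (p i) W \<union> {{a, b}}"
    using e ab sub path_E by auto
  moreover have "V = P \<union> W"
    using p_in_V by auto
  ultimately show ?thesis
    using star_on_path_bound[of p d i W a b E V] inj assms d finite_W ab b by auto
qed

text \<open>Both edges off the path leave the only outer vertex, and their ends on the path are at
  most two apart. Since \<open>d\<close> is at least 4, they are not the two ends of the path, so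
  one of them is a centre. This secures two outer vertices whenever a leaf has to be
  removed.\<close>

lemma star_if_single:
  assumes "card W = 1"
  obtains i where "0 < i" "i < d" "\<And>w. w \<in> W \<Longrightarrow> {p i, w} \<in> E"
proof -
  obtain w where w: "W = {w}"
    using assms by (auto simp: card_1_singleton_iff)
  have ex: "\<exists>k\<le>d. e = {w, p k}" if "e \<in> N" for e
  proof -
    obtain a b where "e = {a, b}" "a \<in> W" "b \<in> V" "a \<noteq> b"
      using N_meets_W \<open>e \<in> N\<close> by blast
    moreover from this have "b \<in> P"
      using w by auto
    ultimately show ?thesis
      using w by auto
  qed
  have "card N = 2"
    using card_N assms by simp
  then obtain e f where ef: "N = {e, f}" "e \<noteq> f"
    by (auto simp: card_2_iff)
  then obtain k l where kl: "k \<le> d" "l \<le> d" "e = {w, p k}" "f = {w, p l}"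
    using ex by (metis insertI1 insertI2)
  then have "k \<noteq> l" "{w, p k} \<in> E" "{w, p l} \<in> E"
    using ef by auto
  moreover from this have "k \<le> l + 2" "l \<le> k + 2"
    using close[of w] kl w by auto
  moreover have "0 < k \<and> k < d \<or> 0 < l \<and> l < d"
    using calculation kl(1,2) d by linarith
  ultimately show ?thesis
    using that[of k] that[of l] w by (auto simp: insert_commute)
qed

lemma path_graph_remove_leaf:
  assumes "v \<in> W" "{e \<in> E. v \<in> e} = {{u, v}}" "u \<noteq> v"
  shows "path_graph (V - {v}) (E - {{u, v}}) p d"
proof
  have uv: "{u, v} \<in> E"
    using assms(2) by auto
  show "finite (V - {v})"
    using finite_V by simp
  show "e \<subseteq> V - {v} \<and> card e = 2" if "e \<in> E - {{u, v}}" for e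
    using that E[of e] assms(2) by auto
  show "card (E - {{u, v}}) = card (V - {v})"
    using uv assms(1) finite_E finite_V card_E by simp
  show "path_edges p d \<subseteq> E - {{u, v}}"
    using path_E path_edges_subset_P assms(1) by auto
  show "\<exists>x\<in>S. \<exists>y\<in>V - {v} - S. {x, y} \<in> E - {{u, v}}" if S: "S \<subseteq> V - {v} - P" "S \<noteq> {}" for S
  proof (cases "u \<in> S")
    case True
    \<comment> \<open>The set is enlarged by \<open>v\<close> before cutting: the only neighbour of
      \<open>v\<close> lies inside, so the edge found starts in \<open>S\<close> and survives the
      removal.\<close>
    then obtain x y where xy: "x \<in> insert v S" "y \<in> V - insert v S" "{x, y} \<in> E"
      using cut[of "insert v S"] S assms(1) by auto
    have "x \<noteq> v"
    proof
      assume "x = v"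
      then have "{v, y} \<in> {e \<in> E. v \<in> e}"
        using xy by auto
      then have "y = u"
        using assms(2) xy by (auto simp: doubleton_eq_iff)
      then show False
        using xy True by auto
    qed
    then show ?thesis
      using xy by (intro bexI[of _ x] bexI[of _ y]) (auto simp: doubleton_eq_iff)
  next
    case False
    then obtain x y where xy: "x \<in> S" "y \<in> V - S" "{x, y} \<in> E"
      using cut[of S] S by auto
    then have neq: "{x, y} \<noteq> {u, v}"
      using S False by (auto simp: doubleton_eq_iff)
    moreover have "y \<noteq> v"
    proof
      assume "y = v"
      then have "{x, y} \<in> {e \<in> E. v \<in> e}"
        using xy by auto
      then show False
        using neq assms(2) by simp
    qed
    ultimately show ?thesis
      using xy by (intro bexI[of _ x] bexI[of _ y]) auto
  qed
  show "k \<le> l + 1" if "k \<le> d" "l \<le> d" "{p k, p l} \<in> E - {{u, v}}" for k l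
    using that by (intro chordless DiffD1[OF that(3)])
  show "k \<le> l + 2"
    if "w \<in> V - {v} - P" "k \<le> d" "l \<le> d" "{w, p k} \<in> E - {{u, v}}" "{w, p l} \<in> E - {{u, v}}" for w k l
    by (rule close[of w k l]) (use that in blast)+
  show "P \<subseteq> V - {v}"
    using p_in_V assms(1) by blast
qed (fact d inj)+

text \<open>An outer vertex meets only the \<open>card W + 1\<close> edges off the path. An inner
  path vertex has two path neighbours but misses some outer vertex; an end of the path may see all
  of them but has one path neighbour.\<close>

lemma edge_degree_le_if_no_star:
  assumes "W \<noteq> {}" "u \<in> V" and no: "\<And>i. \<lbrakk>0 < i; i < d\<rbrakk> \<Longrightarrow> \<exists>w\<in>W. {p i, w} \<notin> E"
  shows "edge_degree E u \<le> card W + 1"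
proof (cases "u \<in> W")
  case True
  have "card {e \<in> N. u \<in> e} \<le> card N"
    using finite_E by (intro card_mono) auto
  then show ?thesis
    using edge_degree_W[OF True] card_N by (simp add: edge_degree_def)
next
  case False
  then obtain k where k: "k \<le> d" "u = p k"
    using assms(2) by auto
  show ?thesis
  proof (cases "0 < k \<and> k < d")
    case True
    then have "{w \<in> W. {p k, w} \<in> E} \<subset> W"
      using no[of k] by auto
    then have "card {w \<in> W. {p k, w} \<in> E} < card W"
      using finite_W by (intro psubset_card_mono)
    then show ?thesis
      using edge_degree_P_le[OF k(1)] edge_degree_split[of u] k True
      by (simp add: edge_degree_path_edges[OF inj])
  next
    case False
    have "card {w \<in> W. {p k, w} \<in> E} \<le> card W"
      using finite_W by (intro card_mono) auto
    then show ?thesis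
      using False edge_degree_P_le[OF k(1)] edge_degree_split[of u] k d
      by (auto simp add: edge_degree_path_edges[OF inj])
  qed
qed

text \<open>A discharging argument: the excess of an edge over \<open>sqrt 8\<close> is charged to
  its ends, so a vertex of degree \<open>g\<close> collects at most
  \<open>g * degree_excess g\<close>. The lower bounds \<open>base\<close> sum to
  \<open>2 * card V - 2\<close> and the degrees to \<open>2 * card V\<close>, so only two units of
  surplus degree are available.\<close>

lemma leafless_bound:
  assumes "2 \<le> card W" "\<And>w. w \<in> W \<Longrightarrow> 2 \<le> edge_degree E w"
  shows "sombor E < extremal_value (card W) d"
proof -
  let ?g = "edge_degree E"
  define base where "base = (\<lambda>v. if v \<in> {p 0, p d} then 1 else 2 :: nat)"
  have ge: "base v \<le> ?g v" if "v \<in> V" for v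
  proof (cases "v \<in> W")
    case True
    then show ?thesis
      using assms(2) by (auto simp: base_def)
  next
    case False
    then obtain k where k: "k \<le> d" "v = p k"
      using \<open>v \<in> V\<close> by auto
    then show ?thesis
      using edge_degree_split[of v] d
      by (auto simp: base_def edge_degree_path_edges[OF inj] p_eq_iff)
  qed
  have "p 0 \<noteq> p d" "{p 0, p d} \<subseteq> V"
    using d p_eq_iff[of 0 d] p_in_V by auto
  have "(\<Sum>v\<in>V. real (?g v)) = 2 * real (card V)"
    using sum_edge_degree[OF finite_V finite_E E] card_E by (simp flip: of_nat_sum)
  moreover have "(\<Sum>v\<in>V. real (base v)) = 2 * real (card V) - 2"
  proof -
    have "(\<Sum>v\<in>V. base v) = (\<Sum>v\<in>V - {p 0, p d}. base v) + (\<Sum>v\<in>{p 0, p d}. base v)"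
      using finite_V \<open>{p 0, p d} \<subseteq> V\<close> by (rule sum.subset_diff[rotated])
    also have "(\<Sum>v\<in>V - {p 0, p d}. base v) = (\<Sum>v\<in>V - {p 0, p d}. 2)"
      by (intro sum.cong) (auto simp: base_def)
    also have "\<dots> = 2 * (card V - 2)"
      using \<open>p 0 \<noteq> p d\<close> \<open>{p 0, p d} \<subseteq> V\<close> by (simp add: card_Diff_subset)
    finally have "(\<Sum>v\<in>V. base v) = 2 * (card V - 2) + 2"
      using \<open>p 0 \<noteq> p d\<close> by (simp add: base_def)
    moreover have "2 \<le> card V"
      using card_V d by simp
    ultimately have "(\<Sum>v\<in>V. base v) = 2 * card V - 2" "2 \<le> card V"
      by auto
    then show ?thesis
      by (simp add: of_nat_diff flip: of_nat_sum)
  qed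
  ultimately have eps: "(\<Sum>v\<in>V. real (?g v) - real (base v)) = 2"
    by (simp add: sum_subtractf)
  have le2: "?g v \<le> base v + 2" if "v \<in> V" for v
  proof -
    have "real (?g v) - real (base v) \<le> (\<Sum>v\<in>V. real (?g v) - real (base v))"
      using finite_V that ge by (intro member_le_sum) auto
    then show ?thesis
      using eps by linarith
  qed
  have le4: "?g v \<le> 4" if "v \<in> V" for v
    using le2[OF that] by (auto simp: base_def split: if_splits)
  have edge: "sqrt (\<Sum>v\<in>e. (real (?g v))\<^sup>2) \<le> sqrt 8 + (\<Sum>v\<in>e. degree_excess (?g v))"
    if "e \<in> E" for e
  proof -
    obtain x y where xy: "e = {x, y}" "x \<noteq> y" "x \<in> V" "y \<in> V"
      using E[OF \<open>e \<in> E\<close>] by (auto simp: card_2_iff)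
    show ?thesis
      using hyp_le_degree_excess[OF le4 le4, OF xy(3,4)] xy(2)
      unfolding xy(1) sqrt_sum_doubleton[OF xy(2)] by simp
  qed
  \<comment> \<open>The rate per unit of surplus is attained at degree 4 with base 2. An end of the
    path has base 1 and cannot reach degree 4.\<close>
  have vertex: "real (?g v) * degree_excess (?g v)
      \<le> 2 * (sqrt 20 - sqrt 8) * (real (?g v) - real (base v))" if "v \<in> V" for v
  proof -
    have "?g v \<le> 2 \<or> ?g v = 3 \<or> ?g v = 4"
      using le4[OF that] by auto
    moreover have "base v = 1 \<or> base v = 2" "base v \<le> ?g v"
      using ge[OF that] by (auto simp: base_def)
    moreover have "?g v = 4 \<Longrightarrow> base v = 2"
      using le2[OF that] \<open>base v = 1 \<or> base v = 2\<close> by auto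
    ultimately show ?thesis
      using sqrt_bounds by (auto simp: degree_excess_def)
  qed
  have "sombor E \<le> (\<Sum>e\<in>E. sqrt 8 + (\<Sum>v\<in>e. degree_excess (?g v)))"
    unfolding sombor_def by (intro sum_mono edge)
  also have "\<dots> = card V * sqrt 8 + (\<Sum>e\<in>E. \<Sum>v\<in>V. if v \<in> e then degree_excess (?g v) else 0)"
  proof -
    have "(\<Sum>v\<in>e. degree_excess (?g v)) = (\<Sum>v\<in>V. if v \<in> e then degree_excess (?g v) else 0)"
      if "e \<in> E" for e
    proof -
      have "{v \<in> V. v \<in> e} = e"
        using E[OF that] by auto
      then show ?thesis
        using finite_V by (simp flip: sum.inter_filter)
    qed
    then show ?thesis
      by (simp add: sum.distrib card_E)
  qed
  also have "(\<Sum>e\<in>E. \<Sum>v\<in>V. if v \<in> e then degree_excess (?g v) else 0)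
      = (\<Sum>v\<in>V. \<Sum>e\<in>E. if v \<in> e then degree_excess (?g v) else 0)"
    by (rule sum.swap)
  also have "\<dots> = (\<Sum>v\<in>V. real (?g v) * degree_excess (?g v))"
    using finite_E by (simp add: edge_degree_def flip: sum.inter_filter)
  also have "\<dots> \<le> (\<Sum>v\<in>V. 2 * (sqrt 20 - sqrt 8) * (real (?g v) - real (base v)))"
    by (intro sum_mono vertex)
  also have "\<dots> = 4 * (sqrt 20 - sqrt 8)"
    using eps by (simp flip: sum_distrib_left)
  finally show ?thesis
    using extremal_value_gt_flat[OF assms(1) d] card_V by (simp add: algebra_simps)
qed

end

section \<open>The bound relative to a fixed path\<close>

theorem path_graph_sombor_le:
  assumes "path_graph V E p d" "V - p ` {..d} \<noteq> {}"
  shows "sombor E \<le> extremal_value (card (V - p ` {..d})) d \<and>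
    (sombor E = extremal_value (card (V - p ` {..d})) d \<longrightarrow> extremal_shape V E d)"
  using assms
proof (induction "card V" arbitrary: V E rule: less_induct)
  case less
  interpret path_graph V E p d
    by fact
  show ?case
  proof (cases "\<exists>i. 0 < i \<and> i < d \<and> (\<forall>w\<in>W. {p i, w} \<in> E)")
    case True
    then show ?thesis
      using star_bound less.prems(2) by blast
  next
    case no_star: False
    have "card W \<noteq> 1"
      using star_if_single no_star by metis
    then have m: "2 \<le> card W"
      using card_gt_0_iff[of W] less.prems(2) finite_W by linarith
    show ?thesis
    proof (cases "\<exists>v\<in>W. edge_degree E v \<le> 1")
      case True
      then obtain v where v: "v \<in> W" "edge_degree E v = 1"
        using edge_degree_W_pos by (metis le_antisym)
      then obtain e where e: "{e \<in> E. v \<in> e} = {e}"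
        unfolding edge_degree_def by (metis (no_types, lifting) One_nat_def card_1_singletonE)
      then have "e \<in> E" "v \<in> e"
        by auto
      then obtain u where u: "e = {u, v}" "u \<noteq> v" "u \<in> V"
        using E[of e] by (auto simp: card_2_iff insert_commute)
      have "1 \<le> edge_degree E u"
        using edge_degree_pos[OF finite_E \<open>e \<in> E\<close>] u by auto
      then obtain s where s: "edge_degree E u = Suc s"
        by (cases "edge_degree E u") auto
      have "edge_degree E u \<le> card W + 1"
        using no_star less.prems(2) u(3) by (intro edge_degree_le_if_no_star) auto
      then have "s \<le> card W"
        using s by simp
      have W': "V - {v} - P = W - {v}" "card (W - {v}) = card W - 1"
        using v finite_W by auto
      have "sombor (E - {{u, v}}) \<le> extremal_value (card W - 1) d"
      proof -
        have "card (W - {v}) \<noteq> 0"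
          using m W'(2) by simp
        then have "V - {v} - P \<noteq> {}"
          using W'(1) by (metis card.empty)
        moreover have "card (V - {v}) < card V"
          using v finite_V by (intro psubset_card_mono) auto
        ultimately show ?thesis
          using less.hyps[of "V - {v}" "E - {{u, v}}"] path_graph_remove_leaf[OF v(1)] e u W' by simp
      qed
      moreover have "sombor E \<le> sombor (E - {{u, v}}) + hyp (real s + 1) 1
          + real s * (hyp (real s + 1) 1 - hyp (real s) 1)"
        using sombor_remove_leaf[OF finite_E _ u(2) _ s] E e u by auto
      ultimately have "sombor E < extremal_value (card W) d"
        using extremal_value_step[OF m \<open>s \<le> card W\<close>, of d] by simp
      then show ?thesis
        by simp
    next
      case False
      then have "sombor E < extremal_value (card W) d"
        using m by (intro leafless_bound) (auto simp: not_le Suc_le_eq numeral_2_eq_2)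
      then show ?thesis
        by simp
    qed
  qed
qed

section \<open>Edge sets, cycles and distances of digraphs\<close>

context pair_graph
begin

lemma arc_sym: "(u, v) \<in> parcs G \<longleftrightarrow> (v, u) \<in> parcs G"
  using pair_sym_arcs by (auto simp: symmetric_def dest: symD)

lemma edge_set_iff: "{u, v} \<in> edge_set G \<longleftrightarrow> (u, v) \<in> parcs G"
  using arc_sym by (auto simp: edge_set_def doubleton_eq_iff image_iff Bex_def)

lemma edge_setE:
  assumes "e \<in> edge_set G"
  obtains u v where "e = {u, v}" "(u, v) \<in> parcs G" "u \<noteq> v" "u \<in> pverts G" "v \<in> pverts G"
  using assms pair_no_loops in_arcsD1 in_arcsD2 by (fastforce simp: edge_set_def)

lemma edge_set_subset: "e \<in> edge_set G \<Longrightarrow> e \<subseteq> pverts G \<and> card e = 2"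
  by (erule edge_setE) auto

lemma finite_edge_set: "finite (edge_set G)"
  using pair_finite_arcs by (simp add: edge_set_def)

lemma degree_eq_edge_degree: "degree G v = edge_degree (edge_set G) v"
proof -
  have "{e \<in> edge_set G. v \<in> e} = (\<lambda>(u, v). {u, v}) ` {a \<in> parcs G. fst a = v}"
  proof (intro equalityI subsetI)
    fix e assume e: "e \<in> {e \<in> edge_set G. v \<in> e}"
    then obtain x y where xy: "e = {x, y}" "(x, y) \<in> parcs G"
      by (auto elim: edge_setE)
    then have "v = x \<or> v = y"
      using e by auto
    then obtain w where "(v, w) \<in> parcs G" "e = {v, w}"
      using xy arc_sym by (metis insert_commute)
    then show "e \<in> (\<lambda>(u, v). {u, v}) ` {a \<in> parcs G. fst a = v}"
      by (intro image_eqI[of _ _ "(v, w)"]) auto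
  qed (auto simp: edge_set_def)
  moreover have "inj_on (\<lambda>(u, v). {u, v}) {a \<in> parcs G. fst a = v}"
    by (auto simp: inj_on_def doubleton_eq_iff)
  ultimately show ?thesis
    by (simp add: edge_degree_def out_degree_def out_arcs_def card_image)
qed

lemma sombor_index_eq: "sombor_index G = sombor (edge_set G)"
  by (simp add: sombor_index_def sombor_def degree_eq_edge_degree)

end

subsection \<open>Cycles\<close>

lemma pawalk_verts_map:
  "i \<le> j \<Longrightarrow> pawalk_verts (x i) (map (\<lambda>k. (x k, x (Suc k))) [i..<j]) = map x [i..<Suc j]"
proof (induction "j - i" arbitrary: i)
  case (Suc n)
  then have "[i..<j] = i # [Suc i..<j]" "[i..<Suc j] = i # [Suc i..<Suc j]" "Suc i \<le> j" "n = j - Suc i"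
    by (auto simp: upt_conv_Cons simp del: upt_Suc)
  with Suc.hyps(1)[of "Suc i"] show ?case
    by simp
qed simp

lemma pcas_map: "i \<le> j \<Longrightarrow> pcas (x i) (map (\<lambda>k. (x k, x (Suc k))) [i..<j]) (x j)"
proof (induction "j - i" arbitrary: i)
  case (Suc n)
  then have "[i..<j] = i # [Suc i..<j]" "Suc i \<le> j" "n = j - Suc i"
    by (auto simp: upt_conv_Cons simp del: upt_Suc)
  with Suc.hyps(1)[of "Suc i"] show ?case
    by simp
qed simp

lemma pcas_obtain_map:
  assumes "pcas u p v"
  obtains x where "x 0 = u" "x (length p) = v" "p = map (\<lambda>k. (x k, x (Suc k))) [0..<length p]"
proof -
  have "\<exists>x. x 0 = u \<and> x (length p) = v \<and> p = map (\<lambda>k. (x k, x (Suc k))) [0..<length p]"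
    using assms
  proof (induction p arbitrary: u)
    case Nil
    then show ?case
      by auto
  next
    case (Cons e p)
    then obtain x where x: "x 0 = snd e" "x (length p) = v" "p = map (\<lambda>k. (x k, x (Suc k))) [0..<length p]"
      by auto
    \<comment> \<open>Prepends \<open>u\<close> to the vertex sequence, shifting the rest by
      one.\<close>
    let ?y = "case_nat u x"
    have "map (\<lambda>k. (?y k, ?y (Suc k))) [0..<length (e # p)] = (u, x 0) # map (\<lambda>k. (x k, x (Suc k))) [0..<length p]"
      by (simp add: map_upt_Suc del: upt_Suc)
    also have "\<dots> = e # p"
      using x Cons.prems by (metis pcas.simps(2) prod.collapse)
    finally show ?case
      using x by (intro exI[of _ ?y]) simp
  qed
  then show ?thesis
    using that by blast
qed

text \<open>Cycles become vertex sequences, accessible to index arithmetic. The starting vertex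
  appears as \<open>x 0\<close> and as \<open>x k\<close>, so injectivity is asked on
  \<open>{0<..k}\<close>, in accordance with the distinct tail in the definition of
  \<open>cycle\<close>.\<close>

lemma (in pair_graph) is_cycle_iff:
  "is_cycle G C \<longleftrightarrow> (\<exists>x k. 3 \<le> k \<and> x k = x 0 \<and> inj_on x {0<..k} \<and>
     (\<forall>i<k. {x i, x (Suc i)} \<in> edge_set G) \<and> C = (\<lambda>i. {x i, x (Suc i)}) ` {..<k})"
proof
  assume "is_cycle G C"
  then obtain p u where p: "awalk u p u" "distinct (tl (pawalk_verts u p))" "3 \<le> length p"
    and C: "C = (\<lambda>(u, v). {u, v}) ` set p"
    by (auto simp: is_cycle_def cycle_def)
  have "pcas u p u" "set p \<subseteq> parcs G"
    using p(1) by (auto simp: awalk_def)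
  then obtain x where x: "x 0 = u" "x (length p) = u" "p = map (\<lambda>k. (x k, x (Suc k))) [0..<length p]"
    by (auto elim: pcas_obtain_map)
  define k where "k = length p"
  have "pawalk_verts u p = map x [0..<Suc k]"
    using pawalk_verts_map[of 0 k x] x by (simp add: k_def)
  then have "distinct (map x [Suc 0..<Suc k])"
    using p(2) by (simp add: upt_conv_Cons del: upt_Suc)
  then have "inj_on x {0<..k}"
    by (simp add: distinct_map atLeastLessThanSuc_atLeastAtMost atLeastSucAtMost_greaterThanAtMost del: upt_Suc)
  moreover have set_p: "set p = (\<lambda>k. (x k, x (Suc k))) ` {..<k}"
    by (subst x(3)) (simp add: k_def lessThan_atLeast0)
  moreover have "\<forall>i<k. {x i, x (Suc i)} \<in> edge_set G"
    using set_p \<open>set p \<subseteq> parcs G\<close> edge_set_iff by auto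
  ultimately show "\<exists>x k. 3 \<le> k \<and> x k = x 0 \<and> inj_on x {0<..k} \<and>
     (\<forall>i<k. {x i, x (Suc i)} \<in> edge_set G) \<and> C = (\<lambda>i. {x i, x (Suc i)}) ` {..<k}"
    using x p(3) C by (intro exI[of _ x] exI[of _ k]) (simp add: k_def image_image)
next
  assume "\<exists>x k. 3 \<le> k \<and> x k = x 0 \<and> inj_on x {0<..k} \<and>
     (\<forall>i<k. {x i, x (Suc i)} \<in> edge_set G) \<and> C = (\<lambda>i. {x i, x (Suc i)}) ` {..<k}"
  then obtain x k where x: "3 \<le> k" "x k = x 0" "inj_on x {0<..k}"
     "\<forall>i<k. {x i, x (Suc i)} \<in> edge_set G" and C: "C = (\<lambda>i. {x i, x (Suc i)}) ` {..<k}"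
    by blast
  let ?p = "map (\<lambda>k. (x k, x (Suc k))) [0..<k]"
  have arcs: "set ?p \<subseteq> parcs G"
    using x(4) edge_set_iff by auto
  have "(x 0, x (Suc 0)) \<in> parcs G"
    using x(1,4) edge_set_iff by auto
  then have "x 0 \<in> pverts G"
    by (rule in_arcsD1)
  then have "awalk (x 0) ?p (x 0)"
    using arcs pcas_map[of 0 k x] x(2) by (simp add: awalk_def)
  moreover have "distinct (tl (pawalk_verts (x 0) ?p))"
  proof -
    have "pawalk_verts (x 0) ?p = map x [0..<Suc k]"
      by (rule pawalk_verts_map) simp
    then show ?thesis
      using x(3) by (simp add: distinct_map upt_conv_Cons atLeastLessThanSuc_atLeastAtMost
          atLeastSucAtMost_greaterThanAtMost del: upt_Suc)
  qed
  ultimately have "cycle ?p"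
    using x(1) by (auto simp: cycle_def)
  then show "is_cycle G C"
    unfolding is_cycle_def using x(1) C by (intro exI[of _ ?p]) (simp add: image_image lessThan_atLeast0)
qed

lemma (in pair_graph) exists_cycle:
  assumes "F \<subseteq> edge_set G" "finite X" "X \<noteq> {}" "\<And>e. e \<in> F \<Longrightarrow> e \<subseteq> X" "card X \<le> card F"
  shows "\<exists>C. is_cycle G C \<and> C \<subseteq> F"
  using assms
proof (induction "card X" arbitrary: X F rule: less_induct)
  case less
  have finF: "finite F"
    using less.prems(1) finite_edge_set finite_subset by blast
  have F: "card e = 2" if "e \<in> F" for e
    using that less.prems(1) edge_set_subset by auto
  show ?case
  proof (cases "\<exists>v\<in>X. edge_degree F v \<le> 1")
    case True
    then obtain v where v: "v \<in> X" "edge_degree F v \<le> 1"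
      by auto
    let ?F = "{e \<in> F. v \<notin> e}"
    have "card F = card ?F + edge_degree F v"
    proof -
      have "F = ?F \<union> {e \<in> F. v \<in> e}"
        by auto
      moreover have "card (?F \<union> {e \<in> F. v \<in> e}) = card ?F + card {e \<in> F. v \<in> e}"
        using finF by (intro card_Un_disjoint) auto
      ultimately show ?thesis
        by (simp add: edge_degree_def)
    qed
    then have "card (X - {v}) \<le> card ?F"
      using v less.prems(2,5) by simp
    moreover have "X - {v} \<noteq> {}"
    proof
      assume "X - {v} = {}"
      then have "X = {v}"
        using v by auto
      have "card e \<le> 1" if "e \<in> F" for e
        using card_mono[of "{v}" e] less.prems(4)[OF that] \<open>X = {v}\<close> by simp
      then have "F = {}"
        using F by force
      then show False
        using less.prems(5) \<open>X = {v}\<close> by simp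
    qed
    moreover have "card (X - {v}) < card X"
      using v less.prems(2) by (intro psubset_card_mono) auto
    ultimately have "\<exists>C. is_cycle G C \<and> C \<subseteq> ?F"
      using less.prems by (intro less.hyps) auto
    then show ?thesis
      by blast
  next
    case False
    have step: "\<exists>w. w \<noteq> u \<and> {v, w} \<in> F" if "{u, v} \<in> F" for u v
    proof -
      have "v \<in> X"
        using less.prems(4) that by auto
      then have "1 < card {e \<in> F. v \<in> e}"
        using False by (auto simp: edge_degree_def not_le)
      then have "\<not> {e \<in> F. v \<in> e} \<subseteq> {{u, v}}"
        using card_mono[of "{{u, v}}" "{e \<in> F. v \<in> e}"] by auto
      then obtain e where e: "e \<in> F" "v \<in> e" "e \<noteq> {u, v}"
        by auto
      then obtain w where "e = {v, w}"
        using F[OF e(1)] by (auto simp: card_2_iff)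
      then show ?thesis
        using e by (auto simp: insert_commute)
    qed
    have "F \<noteq> {}"
      using less.prems(2,3,5) by auto
    then obtain u0 v0 where "{u0, v0} \<in> F"
      using F by (metis card_2_iff ex_in_conv)
    \<comment> \<open>The state is the last edge walked, because the next vertex must differ from
      the previous one.\<close>
    then obtain s :: "nat \<Rightarrow> 'a \<times> 'a" where s: "\<And>n. {fst (s n), snd (s n)} \<in> F"
      "\<And>n. fst (s (Suc n)) = snd (s n) \<and> snd (s (Suc n)) \<noteq> fst (s n)"
      using dependent_nat_choice[of "\<lambda>_ a. {fst a, snd a} \<in> F"
          "\<lambda>_ a b. fst b = snd a \<and> snd b \<noteq> fst a"] step by (metis fst_conv snd_conv)
    define x where "x n = fst (s n)" for n
    have edge: "{x n, x (Suc n)} \<in> F" for n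
      using s by (simp add: x_def)
    have turn: "x (Suc (Suc n)) \<noteq> x n" for n
      using s by (simp add: x_def)
    have loop: "x (Suc n) \<noteq> x n" for n
      using F[OF edge[of n]] by auto
    have "range x \<subseteq> X"
      using edge less.prems(4) by blast
    then have "\<not> inj x"
      using less.prems(2) finite_subset infinite_UNIV_nat finite_imageD by blast
    then have ex: "\<exists>j. \<exists>i<j. x i = x j"
      by (metis injI linorder_neqE_nat)
    \<comment> \<open>Minimality of \<open>j\<close> makes the vertices strictly between distinct
      from each other and from \<open>x i\<close>; \<open>loop\<close> and \<open>turn\<close>
      exclude closed stretches of length 1 and 2.\<close>
    define j where "j = (LEAST j. \<exists>i<j. x i = x j)"
    obtain i where i: "i < j" "x i = x j"
      using LeastI_ex[OF ex] unfolding j_def by blast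
    have min: "x a \<noteq> x b" if "a < b" "b < j" for a b
      using not_less_Least[of b "\<lambda>j. \<exists>i<j. x i = x j"] that unfolding j_def by blast
    have "j \<noteq> Suc i" "j \<noteq> Suc (Suc i)"
      using loop[of i] turn[of i] i by auto
    then have "3 \<le> j - i"
      using i by linarith
    moreover have "inj_on (\<lambda>n. x (i + n)) {0<..j - i}"
    proof (rule linorder_inj_onI)
      fix a b assume "a < b" "a \<in> {0<..j - i}" "b \<in> {0<..j - i}"
      then show "x (i + a) \<noteq> x (i + b)"
        using min[of "i + a" "i + b"] min[of i "i + a"] i by (cases "i + b = j") auto
    qed auto
    ultimately have "is_cycle G ((\<lambda>n. {x (i + n), x (i + Suc n)}) ` {..<j - i})"
      unfolding is_cycle_iff using edge less.prems(1) i
      by (intro exI[of _ "\<lambda>n. x (i + n)"] exI[of _ "j - i"]) auto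
    then show ?thesis
      using edge by (intro exI conjI) auto
  qed
qed

text \<open>With more edges than vertices, an edge of the unique cycle could be deleted and enough
  edges would remain for a cycle avoiding it.\<close>

lemma (in pair_graph) card_edge_set_le_if_unique_cycle:
  assumes "\<exists>!C. is_cycle G C" "pverts G \<noteq> {}"
  shows "card (edge_set G) \<le> card (pverts G)"
proof (rule ccontr)
  assume "\<not> ?thesis"
  then have gt: "card (pverts G) < card (edge_set G)"
    by simp
  obtain C where C: "is_cycle G C" "\<And>C'. is_cycle G C' \<Longrightarrow> C' = C"
    using ex1_implies_ex[OF assms(1)] assms(1) by (metis (no_types))
  from C(1) obtain x k where "3 \<le> k" "\<forall>i<k. {x i, x (Suc i)} \<in> edge_set G"
    "C = (\<lambda>i. {x i, x (Suc i)}) ` {..<k::nat}"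
    unfolding is_cycle_iff by blast
  then have "{x 0, x (Suc 0)} \<in> C" "{x 0, x (Suc 0)} \<in> edge_set G"
    by auto
  then obtain e where "e \<in> C" "e \<in> edge_set G"
    by blast
  then have "card (pverts G) \<le> card (edge_set G - {e})"
    using gt finite_edge_set by simp
  then have "\<exists>C'. is_cycle G C' \<and> C' \<subseteq> edge_set G - {e}"
    using assms(2) pair_finite_verts edge_set_subset by (intro exists_cycle[of _ "pverts G"]) auto
  then show False
    using C(2) \<open>e \<in> C\<close> by blast
qed

subsection \<open>Distances\<close>

locale connected_pair_graph = pair_graph +
  assumes connected: "Digraph_Component.connected (with_proj G)"
begin

lemma verts_nonempty: "pverts G \<noteq> {}"
  using connected by (auto simp: connected_conv)

lemma exists_awalk:
  assumes "u \<in> pverts G" "v \<in> pverts G"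
  shows "\<exists>p. awalk u p v"
proof -
  have "strongly_connected (with_proj G)"
    using symmetric_connected_imp_strongly_connected[OF pair_sym_arcs connected] .
  then show ?thesis
    using assms by (auto simp: strongly_connected_def reachable_awalk)
qed

lemma graph_dist_le: "awalk u p v \<Longrightarrow> graph_dist G u v \<le> length p"
  unfolding graph_dist_def by (rule Least_le) auto

lemma graph_dist_awalk:
  assumes "u \<in> pverts G" "v \<in> pverts G"
  obtains p where "awalk u p v" "length p = graph_dist G u v"
proof -
  have "\<exists>k p. awalk u p v \<and> length p = k"
    using exists_awalk[OF assms] by auto
  then have "\<exists>p. awalk u p v \<and> length p = graph_dist G u v"
    unfolding graph_dist_def by (rule LeastI_ex)
  then show ?thesis
    using that by blast
qed

lemma graph_dist_step:
  assumes "r \<in> pverts G" "(u, v) \<in> parcs G"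
  shows "graph_dist G r v \<le> graph_dist G r u + 1"
proof -
  have u: "u \<in> pverts G"
    using assms(2) in_arcsD1 by auto
  obtain p where p: "awalk r p u" "length p = graph_dist G r u"
    using graph_dist_awalk[OF assms(1) u] .
  have "awalk r (p @ [(u, v)]) v"
    using awalk_appendI[OF p(1)] arc_implies_awalk[OF assms(2)] by simp
  then show ?thesis
    using graph_dist_le[of r "p @ [(u, v)]" v] p(2) by simp
qed

lemma graph_dist_self: "r \<in> pverts G \<Longrightarrow> graph_dist G r r = 0"
  using graph_dist_le[of r "[]" r] by (simp add: awalk_Nil_iff)

lemma graph_dist_parent:
  assumes "r \<in> pverts G" "v \<in> pverts G" "v \<noteq> r"
  shows "\<exists>u. (u, v) \<in> parcs G \<and> graph_dist G r v = graph_dist G r u + 1"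
proof -
  obtain p where p: "awalk r p v" "length p = graph_dist G r v"
    using graph_dist_awalk[OF assms(1,2)] .
  then have "p \<noteq> []"
    using assms(3) by (auto simp: awalk_Nil_iff)
  then obtain q u w where q: "p = q @ [(u, w)]"
    by (metis rev_exhaust surj_pair)
  then have "awalk r q u" "w = v" "(u, v) \<in> parcs G"
    using p(1) by (auto simp: awalk_append_iff awalk_simps)
  then show ?thesis
    using graph_dist_le[of r q u] graph_dist_step[OF assms(1), of u v] p(2) q by (intro exI[of _ u]) auto
qed

text \<open>The edges from the vertices to their parents in a breadth-first search form a set of
  \<open>card (pverts G) - 1\<close> edges without a cycle: a vertex of a cycle at maximal distance from the
  root would have two parents.\<close>

lemma card_edge_set_ge_if_cycle:
  assumes "is_cycle G C"
  shows "card (pverts G) \<le> card (edge_set G)"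
proof -
  obtain r where r: "r \<in> pverts G"
    using verts_nonempty by auto
  let ?\<delta> = "graph_dist G r"
  obtain par where par: "\<And>v. \<lbrakk>v \<in> pverts G; v \<noteq> r\<rbrakk> \<Longrightarrow> (par v, v) \<in> parcs G \<and> ?\<delta> v = ?\<delta> (par v) + 1"
    using graph_dist_parent[OF r] by metis
  let ?T = "(\<lambda>v. {v, par v}) ` (pverts G - {r})"
  have "?T \<subseteq> edge_set G"
    using par edge_set_iff arc_sym by auto
  have "inj_on (\<lambda>v. {v, par v}) (pverts G - {r})"
  proof (rule inj_onI)
    fix v w assume vw: "v \<in> pverts G - {r}" "w \<in> pverts G - {r}" "{v, par v} = {w, par w}"
    show "v = w"
    proof (rule ccontr)
      assume "v \<noteq> w"
      then have "v = par w" "w = par v"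
        using vw(3) by (auto simp: doubleton_eq_iff)
      then show False
        using par[of v] par[of w] vw by auto
    qed
  qed
  then have "card ?T = card (pverts G) - 1"
    using r by (simp add: card_image)
  moreover have "?T \<noteq> edge_set G"
  proof
    assume T: "?T = edge_set G"
    \<comment> \<open>A tree edge joins consecutive levels, so the end that is not farther from
      \<open>r\<close> must be the parent.\<close>
    have parent: "y = par x" if "{x, y} \<in> edge_set G" "?\<delta> y \<le> ?\<delta> x" for x y
    proof -
      obtain v where v: "v \<in> pverts G" "v \<noteq> r" "{x, y} = {v, par v}"
        using \<open>{x, y} \<in> edge_set G\<close> unfolding T[symmetric] by auto
      then show ?thesis
        using par[OF v(1,2)] that(2) by (auto simp: doubleton_eq_iff)
    qed
    obtain x k where x: "3 \<le> k" "x k = x 0" "inj_on x {0<..k}" "\<forall>i<k. {x i, x (Suc i)} \<in> edge_set G"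
      using assms unfolding is_cycle_iff by blast
    define S where "S = (\<lambda>i. ?\<delta> (x i)) ` {0<..k}"
    have S: "finite S" "S \<noteq> {}"
      using x(1) by (auto simp: S_def)
    have "Max S \<in> S"
      using S by (rule Max_in)
    then obtain j where j: "0 < j" "j \<le> k" "Max S = ?\<delta> (x j)"
      by (auto simp: S_def)
    have S_le: "?\<delta> (x i) \<le> ?\<delta> (x j)" if "0 < i" "i \<le> k" for i
      unfolding j(3)[symmetric] using S(1) by (rule Max_ge) (use that in \<open>auto simp: S_def\<close>)
    have max: "?\<delta> (x i) \<le> ?\<delta> (x j)" if "i \<le> k" for i
      using S_le[of i] S_le[of k] that x(1,2) by (cases "i = 0") auto
    \<comment> \<open>The indices \<open>a\<close> and \<open>b\<close> are the cyclic neighbours of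
      \<open>j\<close> within \<open>{1..k}\<close>, with \<open>k\<close> in the place of
      0.\<close>
    define a where "a = (if j = 1 then k else j - 1)"
    define b where "b = (if j = k then 1 else j + 1)"
    have "x (j - 1) = x a"
      using x(2) by (simp add: a_def)
    moreover have "{x (j - 1), x (Suc (j - 1))} \<in> edge_set G"
      using x(4) j(1,2) by (metis Suc_diff_1 Suc_le_eq)
    ultimately have "{x j, x a} \<in> edge_set G"
      using j(1) by (simp add: insert_commute)
    moreover have "{x j, x b} \<in> edge_set G"
      using x(1,2,4) j(2) by (cases "j = k") (auto simp: b_def)
    moreover have ab: "a \<in> {0<..k}" "b \<in> {0<..k}" "a \<noteq> b"
      using x(1) j by (auto simp: a_def b_def)
    ultimately have "x a = x b"
      using parent max by (metis greaterThanAtMost_iff)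
    then show False
      using x(3) ab by (auto dest: inj_onD)
  qed
  then have "card ?T < card (edge_set G)"
    using \<open>?T \<subseteq> edge_set G\<close> finite_edge_set by (intro psubset_card_mono) auto
  ultimately show ?thesis
    by simp
qed

lemma exists_geodesic:
  assumes "r \<in> pverts G" "v \<in> pverts G"
  shows "\<exists>p. (\<forall>k\<le>graph_dist G r v. p k \<in> pverts G \<and> graph_dist G r (p k) = k) \<and>
    (\<forall>k<graph_dist G r v. (p k, p (Suc k)) \<in> parcs G)"
proof -
  have "\<exists>p. (\<forall>k\<le>n. p k \<in> pverts G \<and> graph_dist G r (p k) = k) \<and>
    (\<forall>k<n. (p k, p (Suc k)) \<in> parcs G) \<and> p n = v" if "v \<in> pverts G" "graph_dist G r v = n" for n v
    using that
  proof (induction n arbitrary: v)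
    case 0
    then show ?case
      by (intro exI[of _ "\<lambda>_. v"]) auto
  next
    case (Suc n)
    then have "v \<noteq> r"
      using graph_dist_self[OF assms(1)] by auto
    then obtain u where u: "(u, v) \<in> parcs G" "graph_dist G r u = n"
      using graph_dist_parent[OF assms(1) Suc.prems(1)] Suc.prems(2) by auto
    then obtain p where "\<forall>k\<le>n. p k \<in> pverts G \<and> graph_dist G r (p k) = k"
      "\<forall>k<n. (p k, p (Suc k)) \<in> parcs G" "p n = u"
      using Suc.IH[of u] in_arcsD1 by auto
    then show ?case
      using u Suc.prems by (intro exI[of _ "p(Suc n := v)"]) (auto simp: le_Suc_eq less_Suc_eq)
  qed
  then show ?thesis
    using assms by blast
qed

text \<open>Everything follows from the distance to \<open>r\<close>, which changes by at most 1
  along an edge and equals \<open>k\<close> at \<open>p k\<close>. For the cut property, a vertex of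
  \<open>S\<close> nearest to \<open>r\<close> has its predecessor outside \<open>S\<close>.\<close>

lemma path_graph_if_geodesic:
  assumes r: "r \<in> pverts G" and d: "4 \<le> d" and card: "card (edge_set G) = card (pverts G)"
    and p: "\<forall>k\<le>d. p k \<in> pverts G \<and> graph_dist G r (p k) = k" "\<forall>k<d. (p k, p (Suc k)) \<in> parcs G"
  shows "path_graph (pverts G) (edge_set G) p d"
proof
  have step: "graph_dist G r u \<le> graph_dist G r v + 1" if "{u, v} \<in> edge_set G" for u v
    using that graph_dist_step[OF r] arc_sym edge_set_iff by auto
  show "inj_on p {..d}"
    using p(1) by (metis atMost_iff inj_onI)
  show "path_edges p d \<subseteq> edge_set G"
    using p(2) edge_set_iff by (auto simp: path_edges_def)
  show "k \<le> l + 1" if "k \<le> d" "l \<le> d" "{p k, p l} \<in> edge_set G" for k l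
    using step[OF that(3)] p(1) that by simp
  show "k \<le> l + 2" if "k \<le> d" "l \<le> d" "{w, p k} \<in> edge_set G" "{w, p l} \<in> edge_set G" for w k l
    using step[of "p k" w] step[of w "p l"] p(1) that by (simp add: insert_commute)
  show "\<exists>x\<in>S. \<exists>y\<in>pverts G - S. {x, y} \<in> edge_set G" if S: "S \<subseteq> pverts G - p ` {..d}" "S \<noteq> {}" for S
  proof -
    obtain x where x: "x \<in> S" "\<And>y. y \<in> S \<Longrightarrow> graph_dist G r x \<le> graph_dist G r y"
      using S(2) ex_has_least_nat[of "\<lambda>x. x \<in> S" _ "graph_dist G r"] by (metis ex_in_conv)
    have "r = p 0"
    proof (rule ccontr)
      assume "r \<noteq> p 0"
      then show False
        using graph_dist_parent[OF r, of "p 0"] p(1) by auto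
    qed
    then have "x \<noteq> r"
      using x(1) S(1) by auto
    then obtain y where y: "(y, x) \<in> parcs G" "graph_dist G r x = graph_dist G r y + 1"
      using graph_dist_parent[OF r] x(1) S(1) by blast
    then have "y \<notin> S"
      using x(2)[of y] by auto
    moreover have "y \<in> pverts G" "{x, y} \<in> edge_set G"
      using y(1) in_arcsD1 edge_set_iff arc_sym by blast+
    ultimately show ?thesis
      using x(1) by blast
  qed
qed (use pair_finite_verts edge_set_subset d card p(1) in auto)

lemma diameter_attained:
  obtains u v where "u \<in> pverts G" "v \<in> pverts G" "graph_dist G u v = diameter G"
proof -
  let ?D = "{graph_dist G u v | u v. u \<in> pverts G \<and> v \<in> pverts G}"
  have "?D = (\<lambda>(u, v). graph_dist G u v) ` (pverts G \<times> pverts G)"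
    by auto
  then have "finite ?D" "?D \<noteq> {}"
    using pair_finite_verts verts_nonempty by auto
  then have "diameter G \<in> ?D"
    unfolding diameter_def by (rule Max_in)
  then show ?thesis
    using that by force
qed

end

section \<open>The bound for unicyclic graphs\<close>

theorem unicyclic_sombor_index_le:
  assumes "unicyclic G" "4 \<le> diameter G" "diameter G + 2 \<le> card (pverts G)"
  defines "m \<equiv> card (pverts G) - diameter G - 1"
  shows "sombor_index G \<le> extremal_value m (diameter G)"
    and "sombor_index G = extremal_value m (diameter G) \<Longrightarrow>
      extremal_shape (pverts G) (edge_set G) (diameter G)"
proof -
  interpret connected_pair_graph G
    using assms(1) by (simp add: unicyclic_def connected_pair_graph_def connected_pair_graph_axioms_def)
  have card: "card (edge_set G) = card (pverts G)"
    using assms(1) card_edge_set_le_if_unique_cycle card_edge_set_ge_if_cycle verts_nonempty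
    unfolding unicyclic_def by (metis le_antisym)
  obtain r v where rv: "r \<in> pverts G" "v \<in> pverts G" "graph_dist G r v = diameter G"
    by (rule diameter_attained)
  then obtain p where "path_graph (pverts G) (edge_set G) p (diameter G)"
    using exists_geodesic[OF rv(1,2)] path_graph_if_geodesic[OF rv(1) assms(2) card] by auto
  then interpret P: path_graph "pverts G" "edge_set G" p "diameter G" .
  have "card P.W = m"
    using P.card_V by (simp add: m_def)
  moreover have "P.W \<noteq> {}"
  proof
    assume "P.W = {}"
    then have "card P.W = 0"
      by (simp only: card.empty)
    then show False
      using P.card_V assms(3) by linarith
  qed
  ultimately show "sombor_index G \<le> extremal_value m (diameter G)"
    and "sombor_index G = extremal_value m (diameter G) \<Longrightarrow>
      extremal_shape (pverts G) (edge_set G) (diameter G)"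
    using path_graph_sombor_le[OF P.path_graph_axioms] by (auto simp: sombor_index_eq)
qed

section \<open>The extremal graph\<close>

lemma pair_graph_extremal_graph:
  assumes "4 \<le> d" "d + 2 \<le> n"
  shows "pair_graph (extremal_graph n d)"
proof
  let ?G = "extremal_graph n d"
  let ?A = "{(i, i + 1) | i. 1 \<le> i \<and> i \<le> d} \<union> {(2, d + 2), (4, d + 2)} \<union> {(2, j) | j. d + 3 \<le> j \<and> j \<le> n}"
  have *: "parcs ?G = symcl ?A" "pverts ?G = {1..n}"
    by (simp_all add: extremal_graph_def)
  have A: "a \<in> {1..n} \<and> b \<in> {1..n} \<and> a \<noteq> b" if "(a, b) \<in> parcs ?G" for a b
    using that assms unfolding *(1) symcl_def by auto
  then show "fst e \<in> pverts ?G" "snd e \<in> pverts ?G" "fst e \<noteq> snd e" if "e \<in> parcs ?G" for e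
    using that by (cases e; force simp: *(2))+
  show "finite (pverts ?G)"
    by (simp add: *(2))
  have "parcs ?G \<subseteq> {1..n} \<times> {1..n}"
    using A by auto
  then show "finite (parcs ?G)"
    by (rule finite_subset) simp
  show "symmetric (with_proj ?G)"
    unfolding symmetric_def with_proj_simps *(1) by (auto simp: symcl_def intro!: symI)
qed

lemma extremal_shape_extremal_graph:
  assumes "4 \<le> d" "d + 2 \<le> n"
  shows "extremal_shape (pverts (extremal_graph n d)) (edge_set (extremal_graph n d)) d"
proof -
  let ?A = "{(i, i + 1) | i. 1 \<le> i \<and> i \<le> d} \<union> {(2, d + 2), (4, d + 2)} \<union> {(2, j) | j. d + 3 \<le> j \<and> j \<le> n}"
  let ?u = "\<lambda>(u, v). {u, v :: nat}"
  have "edge_set (extremal_graph n d) = ?u ` symcl ?A"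
    by (simp add: edge_set_def extremal_graph_def)
  also have "\<dots> = ?u ` ?A"
    by (auto simp: symcl_def image_Un insert_commute image_iff)
  \<comment> \<open>The path is \<open>Suc\<close>, as the labels start at 1. The vertex
    \<open>d + 2\<close> joins the pendent vertices in the star, and its edge to vertex 4 is the
    further edge.\<close>
  also have "\<dots> = path_edges Suc d \<union> star_edges (Suc 1) {d + 2..n} \<union> {{d + 2, Suc 3}}"
  proof -
    have "?u ` {(i, i + 1) | i. 1 \<le> i \<and> i \<le> d} = path_edges Suc d"
    proof -
      have "{(i, i + 1) | i. 1 \<le> i \<and> i \<le> d} = (\<lambda>k. (Suc k, Suc (Suc k))) ` {..<d}"
      proof (intro equalityI subsetI)
        fix e assume "e \<in> {(i, i + 1) | i. 1 \<le> i \<and> i \<le> d}"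
        then obtain i where "e = (i, i + 1)" "1 \<le> i" "i \<le> d"
          by auto
        then show "e \<in> (\<lambda>k. (Suc k, Suc (Suc k))) ` {..<d}"
          by (intro image_eqI[of _ _ "i - 1"]) auto
      qed auto
      then show ?thesis
        by (simp add: path_edges_def image_image)
    qed
    moreover have "?u ` {(2, j) | j. d + 3 \<le> j \<and> j \<le> n} = (\<lambda>w. {Suc 1, w}) ` {d + 3..n}"
      by (auto simp: numeral_2_eq_2)
    moreover have "{d + 2..n} = insert (d + 2) {d + 3..n}"
      using assms(2) by auto
    ultimately show ?thesis
      by (auto simp: image_Un star_edges_def insert_commute numeral_2_eq_2)
  qed
  finally have "edge_set (extremal_graph n d)
    = path_edges Suc d \<union> star_edges (Suc 1) {d + 2..n} \<union> {{d + 2, Suc 3}}" .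
  moreover have "pverts (extremal_graph n d) = Suc ` {..d} \<union> {d + 2..n}"
    using assms(2) by (auto simp: extremal_graph_def image_Suc_atMost)
  ultimately show ?thesis
    unfolding extremal_shape_def using assms(2)
    by (intro exI[of _ Suc] exI[of _ "{d + 2..n}"] exI[of _ "d + 2"]) (auto simp: image_Suc_atMost)
qed

lemma sombor_extremal_shape:
  assumes "extremal_shape V E d" "4 \<le> d"
  shows "sombor E = extremal_value (card V - d - 1) d"
proof -
  obtain p W a where p: "inj_on p {..d}" "finite W" "W \<inter> p ` {..d} = {}" "a \<in> W"
     "V = p ` {..d} \<union> W" "E = path_edges p d \<union> star_edges (p 1) W \<union> {{a, p 3}}"
    using assms(1) unfolding extremal_shape_def by blast
  have "p 3 \<noteq> p 1"
    using p(1) assms(2) by (auto simp: inj_on_eq_iff)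
  then interpret path_star_edge p d 1 W a "p 3"
    using p assms(2) by unfold_locales auto
  have "card V = d + 1 + card W"
    using p by (simp add: card_Un_disjoint card_image Int_commute)
  then show ?thesis
    using sombor_extremal p(6) E_def by simp
qed

lemma extremal_shape_bij:
  assumes "extremal_shape V E d" "extremal_shape V' E' d" "card V = card V'" "3 \<le> d"
  obtains \<phi> where "bij_betw \<phi> V V'" "(`) \<phi> ` E = E'"
proof -
  obtain p W a where p: "inj_on p {..d}" "finite W" "W \<inter> p ` {..d} = {}" "a \<in> W"
     "V = p ` {..d} \<union> W" "E = path_edges p d \<union> star_edges (p 1) W \<union> {{a, p 3}}"
    using assms(1) unfolding extremal_shape_def by blast
  obtain q X b where q: "inj_on q {..d}" "finite X" "X \<inter> q ` {..d} = {}" "b \<in> X"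
     "V' = q ` {..d} \<union> X" "E' = path_edges q d \<union> star_edges (q 1) X \<union> {{b, q 3}}"
    using assms(2) unfolding extremal_shape_def by blast
  have "card V = d + 1 + card W" "card V' = d + 1 + card X"
    using p q by (simp_all add: card_Un_disjoint card_image Int_commute)
  then have "card (W - {a}) = card (X - {b})"
    using assms(3) p q by simp
  then obtain g where g: "bij_betw g (W - {a}) (X - {b})"
    using finite_same_card_bij p(2) q(2) by blast
  \<comment> \<open>Path vertices are matched by position and \<open>a\<close> with
    \<open>b\<close>; the remaining outer vertices are interchangeable leaves, so any bijection
    \<open>g\<close> will do.\<close>
  define \<phi> where "\<phi> = (\<lambda>x. if x \<in> W then if x = a then b else g x else q (inv_into {..d} p x))"
  have \<phi>p: "\<phi> (p k) = q k" if "k \<le> d" for k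
    using that p(1,3) by (auto simp: \<phi>_def)
  have \<phi>a: "\<phi> a = b"
    using p(4) by (simp add: \<phi>_def)
  have W: "bij_betw \<phi> W X"
  proof -
    have "bij_betw \<phi> (W - {a}) (X - {b})"
      by (rule bij_betw_cong[THEN iffD1, OF _ g]) (auto simp: \<phi>_def)
    then have "bij_betw \<phi> ((W - {a}) \<union> {a}) ((X - {b}) \<union> {b})"
      by (rule bij_betw_combine) (auto simp: \<phi>a bij_betw_def)
    then show ?thesis
      using p(4) q(4) by (simp add: insert_absorb)
  qed
  have "bij_betw \<phi> (p ` {..d}) (q ` {..d})"
  proof -
    have "inj_on \<phi> (p ` {..d})"
      using q(1) by (auto intro!: inj_onI simp: \<phi>p inj_on_eq_iff)
    then show ?thesis
      by (auto simp: bij_betw_def \<phi>p image_image)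
  qed
  then have "bij_betw \<phi> V V'"
    unfolding p(5) q(5) using W q(3) by (intro bij_betw_combine) auto
  moreover have "(`) \<phi> ` E = E'"
  proof -
    have "(`) \<phi> ` path_edges p d = path_edges q d"
      unfolding path_edges_def image_image by (intro image_cong) (auto simp: \<phi>p)
    moreover have "(`) \<phi> ` star_edges (p 1) W = star_edges (q 1) X"
    proof -
      have "\<phi> ` W = X"
        using W by (simp add: bij_betw_def)
      have "(`) \<phi> ` star_edges (p 1) W = (\<lambda>w. {\<phi> (p 1), \<phi> w}) ` W"
        by (simp add: star_edges_def image_image)
      also have "\<dots> = (\<lambda>w. {q 1, w}) ` \<phi> ` W"
        using \<phi>p[of 1] assms(4) by (simp add: image_image)
      finally show ?thesis
        by (simp add: star_edges_def \<open>\<phi> ` W = X\<close>)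
    qed
    ultimately show ?thesis
      using assms(4) by (simp add: p(6) q(6) image_Un \<phi>a \<phi>p)
  qed
  ultimately show ?thesis
    by (rule that)
qed

section \<open>Isomorphisms\<close>

text \<open>A digraph isomorphism also carries an arc map, but as the tail and head in
  \<open>with_proj H\<close> are \<open>fst\<close> and \<open>snd\<close>, the vertex map
  determines it on the arcs.\<close>

lemma isomorphic_iff:
  assumes "pair_graph G" "pair_graph H"
  shows "isomorphic G H \<longleftrightarrow>
    (\<exists>\<phi>. bij_betw \<phi> (pverts G) (pverts H) \<and> (`) \<phi> ` edge_set G = edge_set H)"
proof
  interpret G: pair_graph G by fact
  interpret H: pair_graph H by fact
  show "\<exists>\<phi>. bij_betw \<phi> (pverts G) (pverts H) \<and> (`) \<phi> ` edge_set G = edge_set H" if iso: "isomorphic G H"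
  proof -
    obtain f where f: "G.digraph_isomorphism f" "with_proj H = app_iso f (with_proj G)"
      using iso unfolding isomorphic_def digraph_iso_def by blast
    let ?\<phi> = "iso_verts f"
    have H: "pverts H = ?\<phi> ` pverts G" "parcs H = iso_arcs f ` parcs G" "iso_tail f = fst" "iso_head f = snd"
      using arg_cong[OF f(2), of verts] arg_cong[OF f(2), of arcs] arg_cong[OF f(2), of tail]
        arg_cong[OF f(2), of head] by simp_all
    have "iso_arcs f (u, v) = (?\<phi> u, ?\<phi> v)" if "(u, v) \<in> parcs G" for u v
      using f(1) that H(3,4) unfolding G.digraph_isomorphism_def by (force intro!: prod_eqI)
    then have "edge_set H = (`) ?\<phi> ` edge_set G"
      unfolding edge_set_def H(2) image_image by (intro image_cong) auto
    moreover have "bij_betw ?\<phi> (pverts G) (pverts H)"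
      using f(1) H(1) unfolding G.digraph_isomorphism_def bij_betw_def by simp
    ultimately show ?thesis
      by auto
  qed
  show "isomorphic G H" if bij: "\<exists>\<phi>. bij_betw \<phi> (pverts G) (pverts H) \<and> (`) \<phi> ` edge_set G = edge_set H"
  proof -
    obtain \<phi> where \<phi>: "bij_betw \<phi> (pverts G) (pverts H)" "(`) \<phi> ` edge_set G = edge_set H"
      using bij by blast
    let ?h = "\<lambda>(u, v). (\<phi> u, \<phi> v)"
    define f where "f = \<lparr>iso_verts = \<phi>, iso_arcs = ?h, iso_head = snd, iso_tail = fst\<rparr>"
    have inj: "inj_on \<phi> (pverts G)"
      using \<phi>(1) by (simp add: bij_betw_def)
    have "inj_on ?h (parcs G)"
      using inj G.in_arcsD1 G.in_arcsD2 by (auto intro!: inj_onI dest: inj_onD)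
    then have "G.digraph_isomorphism f"
      using inj unfolding G.digraph_isomorphism_def f_def by (auto intro: G.wf_digraph_axioms)
    moreover have "parcs H = ?h ` parcs G"
    proof (intro equalityI subsetI)
      fix a assume "a \<in> parcs H"
      obtain x y where a: "a = (x, y)"
        by (cases a)
      then have "{x, y} \<in> (`) \<phi> ` edge_set G"
        using \<open>a \<in> parcs H\<close> H.edge_set_iff \<phi>(2) by simp
      then obtain e where "e \<in> edge_set G" "{x, y} = \<phi> ` e"
        by auto
      then obtain u v where "(u, v) \<in> parcs G" "{x, y} = {\<phi> u, \<phi> v}"
        by (auto elim!: G.edge_setE)
      then show "a \<in> ?h ` parcs G"
        using a G.arc_sym by (force simp: doubleton_eq_iff)
    next
      fix a assume "a \<in> ?h ` parcs G"
      then obtain u v where uv: "(u, v) \<in> parcs G" "a = (\<phi> u, \<phi> v)"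
        by auto
      then have "\<phi> ` {u, v} \<in> edge_set H"
        using G.edge_set_iff \<phi>(2) by blast
      then show "a \<in> parcs H"
        using uv(2) H.edge_set_iff by simp
    qed
    then have "with_proj H = app_iso f (with_proj G)"
      using \<phi>(1) by (simp add: app_iso_def f_def with_proj_def bij_betw_def)
    ultimately show ?thesis
      unfolding isomorphic_def digraph_iso_def by blast
  qed
qed

lemma sombor_index_isomorphic:
  assumes "pair_graph G" "pair_graph H" "isomorphic G H"
  shows "sombor_index G = sombor_index H"
proof -
  interpret G: pair_graph G by fact
  interpret H: pair_graph H by fact
  obtain \<phi> where \<phi>: "bij_betw \<phi> (pverts G) (pverts H)" "(`) \<phi> ` edge_set G = edge_set H"
    using iffD1[OF isomorphic_iff[OF assms(1,2)] assms(3)] by (elim exE conjE)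
  have "inj_on \<phi> (pverts G)"
    using \<phi>(1) by (simp add: bij_betw_def)
  then have "inj_on \<phi> (\<Union> (edge_set G))"
    by (rule inj_on_subset) (use G.edge_set_subset in blast)
  then show ?thesis
    by (simp add: G.sombor_index_eq H.sombor_index_eq sombor_image flip: \<phi>(2))
qed

theorem theorem2p1:
  fixes G :: "'a pair_pre_digraph" and n d :: nat
  assumes "4 \<le> d" and "d \<le> n - 2"
    and "G \<in> unicyclic_graphs n d"
  shows "sombor_index G \<le> sombor_index (extremal_graph n d) \<and>
         (sombor_index G = sombor_index (extremal_graph n d) \<longleftrightarrow> isomorphic G (extremal_graph n d))"
proof -
  let ?H = "extremal_graph n d"
  \<comment> \<open>The truncated difference \<open>n - 2\<close> is at least 4, hence a true
    difference.\<close>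
  have n: "d + 2 \<le> n"
    using assms(1,2) by simp
  have G: "unicyclic G" "card (pverts G) = n" "diameter G = d" "pair_graph G"
    using assms(3) by (auto simp: unicyclic_graphs_def unicyclic_def)
  interpret H: pair_graph ?H
    using pair_graph_extremal_graph assms(1) n .
  have cardH: "card (pverts ?H) = n"
    by (simp add: extremal_graph_def)
  have shapeH: "extremal_shape (pverts ?H) (edge_set ?H) d"
    using extremal_shape_extremal_graph assms(1) n .
  have H: "sombor_index ?H = extremal_value (n - d - 1) d"
    using sombor_extremal_shape[OF shapeH assms(1)] by (simp add: H.sombor_index_eq cardH)
  have "sombor_index G \<le> sombor_index ?H"
    using unicyclic_sombor_index_le(1)[OF G(1)] G assms(1) n H by simp
  moreover have "isomorphic G ?H" if "sombor_index G = sombor_index ?H"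
  proof -
    have "extremal_shape (pverts G) (edge_set G) d"
      using unicyclic_sombor_index_le(2)[OF G(1)] G assms(1) n H that by simp
    then obtain \<phi> where "bij_betw \<phi> (pverts G) (pverts ?H)" "(`) \<phi> ` edge_set G = edge_set ?H"
      by (rule extremal_shape_bij[OF _ shapeH]) (use G(2) cardH assms(1) in auto)
    then show ?thesis
      unfolding isomorphic_iff[OF G(4) H.pair_graph_axioms] by (intro exI conjI)
  qed
  moreover have "sombor_index G = sombor_index ?H" if "isomorphic G ?H"
    using sombor_index_isomorphic[OF G(4) H.pair_graph_axioms that] .
  ultimately show ?thesis
    by blast
qed



end
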